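(* Let $G$ be a locally finite planar graph such that there is a flow $f$ from some vertex $x$ of $G$ with $$\sum_{vw\in E(G)} \left[\deg(v)^2+\deg(w)^2\right] f(vw)^2<\infty.$$ Then $G$ admits a non-constant Dirichlet harmonic function.
   Context: All graphs are simple (no loops or parallel edges). A graph is locally finite if every vertex has finite degree; a graph is planar if it admits an embedding in $\mathbb{R}^2$. For convenience each edge is given a fixed (arbitrary) direction. For $i:E(G)\to\mathbb{R}$, the divergence of $i$ at a vertex $z$ is $i^*(z)=\sum_{zy\in E(G)} i(zy)-\sum_{yz\in E(G)} i(yz)$ (outgoing edges minus incoming edges). A flow from a vertex $x$ (to infinity) is a function $i:E(G)\to\mathbb{R}$ with $i^*(z)=0$ for every vertex $z\ne x$ and $i^*(x)\neq 0$. A function $u:V(G)\to\mathbb{R}$ is harmonic if $u(z)=\frac{1}{\deg(z)}\sum_{y\in N(z)}u(y)$ for every vertex $z$, where $N(z)$ is the set of neighbours of $z$. Its (Dirichlet) energy is $\sum_{zy\in E(G)}(u(z)-u(y))^2$. A Dirichlet harmonic function is a harmonic function with finite energy. *)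

theory Defs
  imports "HOL-Analysis.Analysis"
begin

text \<open>
  A simple graph is given by its vertex set \<open>V\<close> and its set \<open>E\<close> of edges, an edge being the
  two-element set of its endvertices. Both sets may be infinite and the graph need not be connected.
\<close>

definition simple_graph :: "'a set \<Rightarrow> 'a set set \<Rightarrow> bool" where
  "simple_graph V E \<longleftrightarrow> (\<forall>e\<in>E. e \<subseteq> V \<and> card e = 2)"

definition incident_edges :: "'a set set \<Rightarrow> 'a \<Rightarrow> 'a set set" where
  "incident_edges E v = {e \<in> E. v \<in> e}"

definition vertex_degree :: "'a set set \<Rightarrow> 'a \<Rightarrow> nat" where
  "vertex_degree E v = card (incident_edges E v)"

definition neighbours :: "'a set set \<Rightarrow> 'a \<Rightarrow> 'a set" where
  "neighbours E z = {y. {z, y} \<in> E}"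

definition locally_finite_graph :: "'a set \<Rightarrow> 'a set set \<Rightarrow> bool" where
  "locally_finite_graph V E \<longleftrightarrow> (\<forall>v\<in>V. finite (incident_edges E v))"

text \<open>
  An embedding in the plane is a crossing-free drawing: distinct vertices are distinct points, an
  edge is an arc joining its endvertices and meeting no other vertex, and two edges meet only in
  common endvertices. Vertices and edges are allowed to accumulate, even on the drawing itself; the
  drawing is not required to be a homeomorphism from the 1-complex onto its image. The plane
  \<open>\<real>\<^sup>2\<close> is the type \<open>complex\<close>, as in the library's Jordan curve theorem.
\<close>

definition plane_embedding ::
    "'a set \<Rightarrow> 'a set set \<Rightarrow> ('a \<Rightarrow> complex) \<Rightarrow> ('a set \<Rightarrow> real \<Rightarrow> complex) \<Rightarrow> bool" where
  "plane_embedding V E p \<gamma> \<longleftrightarrow>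
     inj_on p V \<and>
     (\<forall>e\<in>E. arc (\<gamma> e) \<and>
            {pathstart (\<gamma> e), pathfinish (\<gamma> e)} = p ` e \<and>
            path_image (\<gamma> e) \<inter> p ` V = p ` e) \<and>
     (\<forall>e\<in>E. \<forall>e'\<in>E. e \<noteq> e' \<longrightarrow>
            path_image (\<gamma> e) \<inter> path_image (\<gamma> e') = p ` (e \<inter> e'))"

definition planar_graph :: "'a set \<Rightarrow> 'a set set \<Rightarrow> bool" where
  "planar_graph V E \<longleftrightarrow> (\<exists>p \<gamma>. plane_embedding V E p \<gamma>)"

text \<open>The direction of the edge \<open>e\<close> is from \<open>tail e\<close> to \<open>head e\<close>.\<close>

definition orientation :: "'a set set \<Rightarrow> ('a set \<Rightarrow> 'a) \<Rightarrow> ('a set \<Rightarrow> 'a) \<Rightarrow> bool" where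
  "orientation E tail head \<longleftrightarrow> (\<forall>e\<in>E. e = {tail e, head e})"

definition divergence ::
    "'a set set \<Rightarrow> ('a set \<Rightarrow> 'a) \<Rightarrow> ('a set \<Rightarrow> 'a) \<Rightarrow> ('a set \<Rightarrow> real) \<Rightarrow> 'a \<Rightarrow> real" where
  "divergence E tail head i z =
     (\<Sum>e\<in>{e \<in> E. tail e = z}. i e) - (\<Sum>e\<in>{e \<in> E. head e = z}. i e)"

definition flow_from ::
    "'a set \<Rightarrow> 'a set set \<Rightarrow> ('a set \<Rightarrow> 'a) \<Rightarrow> ('a set \<Rightarrow> 'a) \<Rightarrow> 'a \<Rightarrow> ('a set \<Rightarrow> real) \<Rightarrow> bool" where
  "flow_from V E tail head x i \<longleftrightarrow>
     x \<in> V \<and>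
     (\<forall>z\<in>V. z \<noteq> x \<longrightarrow> divergence E tail head i z = 0) \<and>
     divergence E tail head i x \<noteq> 0"

text \<open>
  At an isolated vertex, where the defining quotient is \<open>0 / 0\<close>, the HOL convention makes harmonicity
  mean that the function vanishes.
\<close>

definition harmonic :: "'a set \<Rightarrow> 'a set set \<Rightarrow> ('a \<Rightarrow> real) \<Rightarrow> bool" where
  "harmonic V E u \<longleftrightarrow>
     (\<forall>z\<in>V. u z = 1 / real (vertex_degree E z) * (\<Sum>y\<in>neighbours E z. u y))"

text \<open>
  The terms of the energy are non-negative and do not depend on the orientation, so unconditional
  summability over the edge set says that the energy is finite.
\<close>

definition finite_energy ::
    "'a set set \<Rightarrow> ('a set \<Rightarrow> 'a) \<Rightarrow> ('a set \<Rightarrow> 'a) \<Rightarrow> ('a \<Rightarrow> real) \<Rightarrow> bool" where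
  "finite_energy E tail head u \<longleftrightarrow> (\<lambda>e. (u (tail e) - u (head e))\<^sup>2) summable_on E"

definition dirichlet_harmonic ::
    "'a set \<Rightarrow> 'a set set \<Rightarrow> ('a set \<Rightarrow> 'a) \<Rightarrow> ('a set \<Rightarrow> 'a) \<Rightarrow> ('a \<Rightarrow> real) \<Rightarrow> bool" where
  "dirichlet_harmonic V E tail head u \<longleftrightarrow> harmonic V E u \<and> finite_energy E tail head u"

end

theory Submission
  imports Defs "HOL-Library.Transitive_Closure_Table"
begin

text \<open>
  Suppose that every Dirichlet harmonic function is constant on \<open>V\<close>. The graph is then connected, since
  otherwise the indicator of the component of \<open>x\<close> would be harmonic of energy zero; and after scaling,
  \<open>f\<close> has divergence \<open>1\<close> at \<open>x\<close>. Let the \<open>load\<close> of a vertex be the total amount of flow on the edges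
  at it.

  Cauchy-Schwarz at each vertex turns the weighted hypothesis into the finiteness of the sum of
  \<open>deg(v) * load(v)\<^sup>2\<close>. Hence a function whose increment along each edge is at most the sum of the loads
  of its two ends has finite energy; so functions that are Lipschitz for the metric in which passing
  through \<open>v\<close> costs \<open>load v\<close> are available as test functions. On the other
  hand, \<open>f\<close> decomposes into weighted paths (\<open>flow_path_decomposition\<close>), that is, into a random path
  that starts at \<open>x\<close>, leaves a given finite set and visits \<open>v\<close> with probability at most \<open>load v\<close>.
  A fixed vertex set of small total load is therefore missed by the random path with high
  probability, and two independent random paths are unlikely to meet outside a finite set \<open>X\<close> that
  carries nearly all of the sum of the squares of the loads.

  If all Dirichlet harmonic functions are constant, then finitely supported functions are dense in
  energy among the functions of finite energy (\<open>finitely_supported_approximation\<close>): minimise the energy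
  of \<open>u - \<phi>\<close>; the limit is harmonic, so it is constant and the infimum is zero. Since \<open>\<phi>\<close> vanishes far
  away, the variation of \<open>u - \<phi>\<close> along a path controls the value of \<open>u\<close> at the far end, and Cauchy-Schwarz
  against \<open>f\<close> shows that the random path has small variation (\<open>path_test_exists\<close>). So any finite-energy
  function takes, up to a small error, one deterministic value at the far end of the random path. This is
  applied to two kinds of functions. For the distances outside \<open>X\<close> in the metric above it says that
  there is one vertex \<open>q\<close> such that, with high probability, the vertex at which the random path leaves
  \<open>X\<close> for the last time can be joined to \<open>q\<close> by a set of small load that avoids \<open>X\<close>. For the indicators of the
  components that remain after the removal of a larger finite set it says that with high probability all
  random paths end in the same component \<open>K\<close>.

  Take three independent random paths. With positive probability they give three disjoint arms from \<open>X\<close>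
  to \<open>K\<close>, together with a connection from each arm to \<open>q\<close> that avoids \<open>X\<close>, \<open>K\<close> and the other two arms. On each
  arm choose the vertex at which its connection, followed from \<open>q\<close>, first arrives; these
  three vertices are all adjacent to each of three disjoint connected sets: \<open>X\<close> with the initial pieces of the
  arms, \<open>K\<close> with their final pieces, and the union of the connections. This is a \<open>K\<^sub>3\<^sub>,\<^sub>3\<close> minor
  (\<open>no_three_arms\<close>), which a plane graph does not have (\<open>no_K33_minor\<close>, from Janiszewski's theorem and the
  Jordan curve theorem).
\<close>

section \<open>Vertices joined within a set\<close>

text \<open>
  Reachability is a closure of a relation instead of a list of vertices: restricting and enlarging
  the set \<open>A\<close> then needs no surgery on walks.
\<close>

definition joined :: "'a set set \<Rightarrow> 'a set \<Rightarrow> 'a \<Rightarrow> 'a \<Rightarrow> bool" where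
  "joined E A a b \<longleftrightarrow> a \<in> A \<and> (\<lambda>u v. {u, v} \<in> E \<and> v \<in> A)\<^sup>*\<^sup>* a b"

lemma joined_refl: "a \<in> A \<Longrightarrow> joined E A a a"
  by (simp add: joined_def)

lemma joined_step: "joined E A a b \<Longrightarrow> {b, c} \<in> E \<Longrightarrow> c \<in> A \<Longrightarrow> joined E A a c"
  unfolding joined_def by (auto intro: rtranclp.rtrancl_into_rtrancl)

lemma joined_induct [consumes 1, case_names refl step]:
  assumes "joined E A a b" "a \<in> A \<Longrightarrow> P a"
    "\<And>b c. joined E A a b \<Longrightarrow> b \<in> A \<Longrightarrow> c \<in> A \<Longrightarrow> {b, c} \<in> E \<Longrightarrow> P b \<Longrightarrow> P c"
  shows "P b"
proof -
  have a: "a \<in> A" and r: "(\<lambda>u v. {u, v} \<in> E \<and> v \<in> A)\<^sup>*\<^sup>* a b" using assms(1) by (auto simp: joined_def)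
  from r have "P b \<and> b \<in> A"
  proof (induction rule: rtranclp_induct)
    case base
    then show ?case using assms(2) a by simp
  next
    case (step y z)
    then show ?case using assms(3)[of y z] a by (auto simp: joined_def)
  qed
  then show ?thesis ..
qed

lemma joined_right: "joined E A a b \<Longrightarrow> b \<in> A"
  by (induction rule: joined_induct) auto

lemma joined_trans: "joined E A a b \<Longrightarrow> joined E A b c \<Longrightarrow> joined E A a c"
  unfolding joined_def by auto

lemma joined_sym: "joined E A a b \<Longrightarrow> joined E A b a"
proof (induction rule: joined_induct)
  case refl
  then show ?case by (rule joined_refl)
next
  case (step b c)
  have "joined E A c b" using step by (intro joined_step[OF joined_refl]) (auto simp: insert_commute)
  then show ?case using step joined_trans by metis
qed

lemma joined_mono: "joined E A a b \<Longrightarrow> A \<subseteq> B \<Longrightarrow> joined E B a b"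
  by (induction rule: joined_induct) (auto intro: joined_refl joined_step)

definition connected_in :: "'a set set \<Rightarrow> 'a set \<Rightarrow> bool" where
  "connected_in E A \<longleftrightarrow> (\<forall>a\<in>A. \<forall>b\<in>A. joined E A a b)"

lemma connected_inI:
  assumes "\<And>b. b \<in> A \<Longrightarrow> joined E A a b"
  shows "connected_in E A"
  unfolding connected_in_def using assms joined_sym joined_trans by metis

lemma joined_finite:
  assumes "joined E A a b"
  shows "\<exists>R. finite R \<and> R \<subseteq> A \<and> b \<in> R \<and> (\<forall>r\<in>R. joined E R a r)"
  using assms
proof (induction rule: joined_induct)
  case refl
  then show ?case by (intro exI[of _ "{a}"]) (auto intro: joined_refl)
next
  case (step b c)
  then obtain R where R: "finite R" "R \<subseteq> A" "b \<in> R" "\<forall>r\<in>R. joined E R a r" by blast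
  have "joined E (insert c R) a r" if "r \<in> R" for r
    using joined_mono[OF bspec[OF R(4) that] subset_insertI] .
  moreover from this[OF R(3)] have "joined E (insert c R) a c" using step(4) by (rule joined_step) simp
  ultimately show ?case using R step(3) by (intro exI[of _ "insert c R"]) auto
qed

lemma joined_along:
  assumes "successively (\<lambda>a b. {a, b} \<in> E) L" "set L \<subseteq> A" "joined E A a b" "L \<noteq> [] \<Longrightarrow> {b, hd L} \<in> E" "v \<in> set L"
  shows "joined E A a v"
  using assms
proof (induction L arbitrary: b)
  case (Cons c L)
  have c: "joined E A a c" using Cons.prems(2-4) by (auto intro: joined_step)
  show ?case
  proof (cases "v = c")
    case False
    then show ?thesis
      using Cons.prems c by (intro Cons.IH[of c]) (auto simp: successively_Cons)
  qed (use c in simp)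
qed simp

text \<open>
  The connected set of vertices reached from \<open>q\<close> before \<open>T\<close> is hit is adjacent to \<open>T\<close>. It is
  a branch set for a minor in which \<open>p\<close> is a branch vertex.
\<close>

lemma joined_hitting:
  assumes "joined E R q v" "q \<notin> T" "v \<in> T"
  shows "\<exists>p\<in>T \<inter> R. \<exists>c. joined E (R - T) q c \<and> {c, p} \<in> E"
proof -
  have "(\<exists>p\<in>T \<inter> R. \<exists>c. joined E (R - T) q c \<and> {c, p} \<in> E) \<or> joined E (R - T) q v"
    using assms(1)
  proof (induction rule: joined_induct)
    case refl
    then show ?case using assms(2) by (auto intro: joined_refl)
  next
    case (step b c)
    then show ?case by (cases "c \<in> T") (auto intro: joined_step)
  qed
  then show ?thesis using assms(3) joined_right by fast
qed

lemma joined_from_hd: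
  assumes "successively (\<lambda>a b. {a, b} \<in> E) L" "u \<in> set L" "set L \<subseteq> A"
  shows "joined E A (hd L) u"
proof -
  obtain h M where L: "L = h # M" using assms(2) by (cases L) auto
  have h: "joined E A h h" using assms(3) L by (auto intro: joined_refl)
  show ?thesis
  proof (cases "u = h")
    case False
    then have "joined E A h u"
      using assms L by (intro joined_along[OF _ _ h, of M u]) (auto simp: successively_Cons)
    then show ?thesis using L by simp
  qed (use h L in simp)
qed

section \<open>Three tripods in the plane\<close>

text \<open>
  Follow a path from \<open>p\<close> to \<open>G\<close> and stop at the first point of \<open>G\<close>. The set \<open>L - {a}\<close> is connected since it
  is the image of a half-open interval.
\<close>

lemma leg_to_closed_set:
  fixes Z G :: "'a::real_normed_vector set"
  assumes Z: "path_connected Z" and p: "p \<in> Z" "p \<notin> G" and G: "closed G" "G \<inter> Z \<noteq> {}"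
  obtains L a where "compact L" "connected L" "connected (L - {a})" "L \<subseteq> Z" "p \<in> L" "L \<inter> G = {a}"
proof -
  obtain c where c: "c \<in> G" "c \<in> Z" using G by blast
  obtain g where g: "path g" "path_image g \<subseteq> Z" "pathstart g = p" "pathfinish g = c"
    using Z p c unfolding path_connected_def by blast
  have "pathfinish g \<notin> - G" using g c by simp
  then obtain u where u: "0 \<le> u" "u \<le> 1" "\<And>t. 0 \<le> t \<and> t < u \<Longrightarrow> g t \<in> interior (- G)"
      "g u \<notin> interior (- G)" "u = 0 \<or> g u \<in> closure (- G)"
    using subpath_to_frontier_explicit[OF g(1)] by metis
  have int: "interior (- G) = - G" using G(1) by (simp add: interior_open open_Compl)
  have cont: "continuous_on {0..u} g"
    using g(1) u(1,2) unfolding path_def by (auto intro: continuous_on_subset)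
  have minus: "g ` {0..u} - {g u} = g ` {0..<u}"
  proof
    show "g ` {0..u} - {g u} \<subseteq> g ` {0..<u}" by (auto simp: less_le)
    show "g ` {0..<u} \<subseteq> g ` {0..u} - {g u}"
    proof
      fix y assume "y \<in> g ` {0..<u}"
      then obtain t where t: "y = g t" "0 \<le> t" "t < u" by auto
      then have "g t \<notin> G" "g u \<in> G" using u(3)[of t] u(4) int by auto
      then show "y \<in> g ` {0..u} - {g u}" using t by auto
    qed
  qed
  show thesis
  proof
    show "compact (g ` {0..u})" "connected (g ` {0..u})"
      using cont by (auto intro: compact_continuous_image connected_continuous_image)
    show "connected (g ` {0..u} - {g u})"
      unfolding minus
      by (rule connected_continuous_image) (use cont in \<open>auto intro: continuous_on_subset\<close>)
    show "g ` {0..u} \<subseteq> Z" using g(2) u(2) unfolding path_image_def by auto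
    show "p \<in> g ` {0..u}" using g(3) u(1) unfolding pathstart_def by force
    show "g ` {0..u} \<inter> G = {g u}"
    proof
      show "g ` {0..u} \<inter> G \<subseteq> {g u}"
      proof
        fix y assume "y \<in> g ` {0..u} \<inter> G"
        then obtain t where t: "y = g t" "0 \<le> t" "t \<le> u" "g t \<in> G" by auto
        then have "\<not> t < u" using u(3)[of t] int by auto
        then show "y \<in> {g u}" using t by auto
      qed
    qed (use u int in auto)
  qed
qed

text \<open>
  The topological core of the non-planarity of \<open>K\<^sub>3\<^sub>,\<^sub>3\<close>: three sets in the plane that meet
  only in three common points \<open>p1\<close>, \<open>p2\<close>, \<open>p3\<close> cannot all be path-connected in a way that survives the removal of
  any one or two of these points.
  
  Arcs from \<open>p1\<close> to \<open>p2\<close> inside \<open>A\<close> and inside \<open>B\<close> form a Jordan curve \<open>J\<close>. A leg inside \<open>A\<close> and a leg inside \<open>B\<close>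
  connect \<open>p3\<close> to two points of \<open>J\<close>, which split \<open>J\<close> into a part through \<open>p1\<close> and a part through \<open>p2\<close>. Let
  \<open>M\<close> be the union of the legs, and let \<open>S\<close> and \<open>T\<close> consist of \<open>M\<close> and the part through \<open>p1\<close> or \<open>p2\<close>, respectively.
  The legs and the rest of \<open>C\<close> hang together at \<open>p3\<close>, so they lie on one side of \<open>J\<close>. Let \<open>D\<close> be the other side
  and let \<open>y\<close> be a point of \<open>C\<close>. Every point of \<open>J\<close> is on the frontier of \<open>D\<close>; hence without crossing \<open>S\<close> one gets
  from \<open>D\<close> to \<open>p2\<close> and inside \<open>C\<close> on to \<open>y\<close>, and likewise through \<open>p1\<close> without crossing \<open>T\<close>. As \<open>S \<inter> T = M\<close> is
  connected, Janiszewski's theorem joins \<open>D\<close> to \<open>y\<close> without crossing \<open>S \<union> T\<close>, which contains \<open>J\<close>. This is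
  absurd.
\<close>

lemma no_three_tripods:
  fixes A B C :: "complex set"
  assumes dist: "p1 \<noteq> p2" "p1 \<noteq> p3" "p2 \<noteq> p3"
    and AB: "A \<inter> B \<subseteq> {p1, p2, p3}" and AC: "A \<inter> C \<subseteq> {p1, p2, p3}" and BC: "B \<inter> C \<subseteq> {p1, p2, p3}"
    and ps: "{p1, p2, p3} \<subseteq> A" "{p1, p2, p3} \<subseteq> B" "{p1, p2, p3} \<subseteq> C"
    and conn: "\<And>Z F. Z \<in> {A, B, C} \<Longrightarrow> F \<subset> {p1, p2, p3} \<Longrightarrow> path_connected (Z - F)"
  shows False
proof -
  \<comment> \<open>The main arc and the third leg, for either of the sets that contribute to the curve.\<close>
  have half: "\<exists>g t L. arc g \<and> path_image g \<subseteq> Z - {p3} \<and> pathstart g = p1 \<and> pathfinish g = p2 \<and> 0 < t \<and> t < 1 \<and>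
       compact L \<and> connected L \<and> connected (L - {g t}) \<and> L \<subseteq> Z - {p1, p2} \<and> p3 \<in> L \<and> L \<inter> path_image g = {g t}"
    if Z: "Z \<in> {A, B, C}" for Z
  proof -
    have "path_connected (Z - {p3})" by (rule conn[OF Z]) (use dist in auto)
    moreover have "p1 \<in> Z - {p3}" "p2 \<in> Z - {p3}" using Z ps dist by auto
    ultimately obtain g where g: "arc g" "path_image g \<subseteq> Z - {p3}" "pathstart g = p1" "pathfinish g = p2"
      using dist(1) unfolding path_connected_arcwise by blast
    have pc: "path_connected (Z - {p1, p2})" by (rule conn[OF Z]) (use dist in auto)
    have inj: "inj_on g {0..1}" using g(1) by (simp add: arc_def)
    have ends: "g 0 = p1" "g 1 = p2" using g by (auto simp: pathstart_def pathfinish_def)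
    have "g (1/2) \<noteq> g 0" "g (1/2) \<noteq> g 1" using inj by (auto dest: inj_onD)
    moreover have "g (1/2) \<in> path_image g" unfolding path_image_def by auto
    ultimately have "g (1/2) \<in> path_image g \<inter> (Z - {p1, p2})" using g(2) ends by auto
    then have ne: "path_image g \<inter> (Z - {p1, p2}) \<noteq> {}" by blast
    have p3: "p3 \<in> Z - {p1, p2}" "p3 \<notin> path_image g" using Z ps dist g(2) by auto
    obtain L a where L: "compact L" "connected L" "connected (L - {a})" "L \<subseteq> Z - {p1, p2}"
        "p3 \<in> L" "L \<inter> path_image g = {a}"
      using leg_to_closed_set[OF pc p3(1) p3(2) closed_arc_image[OF g(1)] ne] by blast
    then obtain t where t: "a = g t" "0 \<le> t" "t \<le> 1" unfolding path_image_def by fastforce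
    have "a \<noteq> p1" "a \<noteq> p2" using L by auto
    then have "0 < t" "t < 1" using t ends by (auto simp: less_le)
    then show ?thesis using g L t by blast
  qed
  obtain g s LA where g: "arc g" "path_image g \<subseteq> A - {p3}" "pathstart g = p1" "pathfinish g = p2"
    and s: "0 < s" "s < 1"
    and LA: "compact LA" "connected LA" "connected (LA - {g s})" "LA \<subseteq> A - {p1, p2}" "p3 \<in> LA" "LA \<inter> path_image g = {g s}"
    using half[of A] by blast
  obtain h t LB where h: "arc h" "path_image h \<subseteq> B - {p3}" "pathstart h = p1" "pathfinish h = p2"
    and t: "0 < t" "t < 1"
    and LB: "compact LB" "connected LB" "connected (LB - {h t})" "LB \<subseteq> B - {p1, p2}" "p3 \<in> LB" "LB \<inter> path_image h = {h t}"
    using half[of B] by blast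
  have half_arc: "compact (k ` {0..r})" "compact (k ` {r..1})" "k ` {0..r} \<inter> k ` {r..1} = {k r}"
      "k ` {0..r} \<union> k ` {r..1} = path_image k" "pathfinish k \<notin> k ` {0..r}" "pathstart k \<notin> k ` {r..1}"
    if "arc k" "0 < r" "r < 1" for k :: "real \<Rightarrow> complex" and r
  proof -
    have inj: "inj_on k {0..1}" and "continuous_on {0..1} k" using that by (auto simp: arc_def path_def)
    then have "continuous_on {0..r} k" "continuous_on {r..1} k"
      using that by (auto intro: continuous_on_subset)
    then show "compact (k ` {0..r})" "compact (k ` {r..1})" by (auto intro: compact_continuous_image)
    have "k ` {0..r} \<inter> k ` {r..1} = k ` ({0..r} \<inter> {r..1})"
      by (rule inj_on_image_Int[OF inj, symmetric]) (use that in auto)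
    also have "{0..r} \<inter> {r..1} = {r}" using that by auto
    finally show "k ` {0..r} \<inter> k ` {r..1} = {k r}" by simp
    have "{0..r} \<union> {r..1} = {0..1}" using that by auto
    then show "k ` {0..r} \<union> k ` {r..1} = path_image k" by (metis image_Un path_image_def)
    show "pathfinish k \<notin> k ` {0..r}"
      using that by (auto simp: pathfinish_def dest: inj_onD[OF inj])
    show "pathstart k \<notin> k ` {r..1}"
      using that by (auto simp: pathstart_def dest: inj_onD[OF inj])
  qed
  define g1 where "g1 = g ` {0..s}"
  define g2 where "g2 = g ` {s..1}"
  define h1 where "h1 = h ` {0..t}"
  define h2 where "h2 = h ` {t..1}"
  note gh = half_arc[OF g(1) s, folded g1_def g2_def] and hh = half_arc[OF h(1) t, folded h1_def h2_def]
  define M where "M = LA \<union> LB"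
  define S where "S = g1 \<union> h1 \<union> M"
  define T where "T = g2 \<union> h2 \<union> M"
  define J where "J = path_image g \<union> path_image h"
  have gi: "path_image g \<inter> path_image h = {p1, p2}"
  proof
    show "path_image g \<inter> path_image h \<subseteq> {p1, p2}" using g(2) h(2) AB by blast
    show "{p1, p2} \<subseteq> path_image g \<inter> path_image h"
      using g(3,4) h(3,4) pathstart_in_path_image[of g] pathfinish_in_path_image[of g]
        pathstart_in_path_image[of h] pathfinish_in_path_image[of h] by simp
  qed
  have M: "connected M" "compact M"
    unfolding M_def using LA LB by (auto intro!: connected_Un)
  have comp: "compact S" "compact T" unfolding S_def T_def using gh hh M by (auto intro!: compact_Un)
  have "g s \<in> M" "h t \<in> M" using LA LB unfolding M_def by auto
  moreover have "g1 \<inter> h2 = {}"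
  proof -
    have "g1 \<inter> h2 \<subseteq> {p1, p2}" using gi gh(4) hh(4) by blast
    moreover have "p2 \<notin> g1" "p1 \<notin> h2" using gh(5) hh(6) g(4) h(3) by simp_all
    ultimately show ?thesis by blast
  qed
  moreover have "g2 \<inter> h1 = {}"
  proof -
    have "g2 \<inter> h1 \<subseteq> {p1, p2}" using gi gh(4) hh(4) by blast
    moreover have "p1 \<notin> g2" "p2 \<notin> h1" using gh(6) hh(5) g(3) h(4) by simp_all
    ultimately show ?thesis by blast
  qed
  ultimately have ST: "S \<inter> T = M" unfolding S_def T_def using gh(3) hh(3) by (simp add: Int_Un_distrib Int_Un_distrib2) blast
  have STU: "S \<union> T = J \<union> M" unfolding S_def T_def J_def using gh(4) hh(4) by blast
  have simp_loop: "simple_path (g +++ reversepath h)"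
    by (rule simple_path_join_loop) (use g h gi in \<open>auto simp: arc_reversepath\<close>)
  have JJ: "path_image (g +++ reversepath h) = J"
    unfolding J_def using g h by (simp add: path_image_join)
  have "pathfinish (g +++ reversepath h) = pathstart (g +++ reversepath h)"
    using g h by simp
  then have sides: "inside J \<noteq> {}" "open (inside J)" "connected (inside J)" "frontier (inside J) = J"
      "outside J \<noteq> {}" "open (outside J)" "connected (outside J)" "frontier (outside J) = J"
      "inside J \<inter> outside J = {}" "inside J \<union> outside J = - J"
    using Jordan_inside_outside[OF simp_loop] unfolding JJ by blast+
  obtain y where y: "y \<in> C" "y \<notin> {p1, p2, p3}"
  proof -
    have "path_connected (C - {p3})" by (rule conn) (use dist in auto)
    then obtain k where k: "arc k" "path_image k \<subseteq> C - {p3}" "pathstart k = p1" "pathfinish k = p2"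
      using dist ps unfolding path_connected_arcwise by (metis Diff_iff insert_subset singletonD)
    have inj: "inj_on k {0..1}" using k(1) by (simp add: arc_def)
    then have "k (1/2) \<noteq> k 0" "k (1/2) \<noteq> k 1" by (auto dest: inj_onD)
    moreover have "k (1/2) \<in> path_image k" unfolding path_image_def by auto
    ultimately show thesis using k that[of "k (1/2)"] by (auto simp: pathstart_def pathfinish_def)
  qed
  have SA: "S \<subseteq> A \<union> B" "T \<subseteq> A \<union> B"
    unfolding S_def T_def M_def using gh(4) hh(4) g(2) h(2) LA(4) LB(4) by auto
  have p2S: "p2 \<notin> S" unfolding S_def M_def using gh(5) hh(5) g(4) h(4) LA(4) LB(4) by auto
  have p1T: "p1 \<notin> T" unfolding T_def M_def using gh(6) hh(6) g(3) h(3) LA(4) LB(4) by auto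
  have yp2: "connected_component (- S) y p2"
  proof (rule connected_component_of_subset)
    have "path_connected (C - {p1, p3})" by (rule conn) (use dist in auto)
    then show "connected_component (C - {p1, p3}) y p2"
      using y ps(3) dist by (auto simp: connected_component_def intro: path_connected_imp_connected)
    show "C - {p1, p3} \<subseteq> - S" using SA(1) AC BC p2S by blast
  qed
  have yp1: "connected_component (- T) y p1"
  proof (rule connected_component_of_subset)
    have "path_connected (C - {p2, p3})" by (rule conn) (use dist in auto)
    then show "connected_component (C - {p2, p3}) y p1"
      using y ps(3) dist by (auto simp: connected_component_def intro: path_connected_imp_connected)
    show "C - {p2, p3} \<subseteq> - T" using SA(2) AC BC p1T by blast
  qed
  \<comment> \<open>The connected set that determines the side of \<open>J\<close> opposite to \<open>D\<close>.\<close>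
  define N where "N = (LA - {g s}) \<union> (LB - {h t}) \<union> (C - {p1, p2})"
  have "p3 \<notin> J" using g(2) h(2) unfolding J_def by auto
  then have "p3 \<noteq> g s" "p3 \<noteq> h t" using LA(6) LB(6) unfolding J_def by auto
  moreover have "path_connected (C - {p1, p2})" by (rule conn) (use dist in auto)
  ultimately have Nconn: "connected N"
    unfolding N_def using LA(3,5) LB(3,5) ps(3) dist
    by (intro connected_Un) (auto intro: path_connected_imp_connected)
  have "LA \<inter> path_image h \<subseteq> {}" "LB \<inter> path_image g \<subseteq> {}"
    using LA(4) LB(4) g(2) h(2) AB by auto
  moreover have "C \<inter> J \<subseteq> {p1, p2}" using g(2) h(2) AC BC unfolding J_def by auto
  ultimately have NJ: "N \<inter> J = {}" unfolding N_def J_def using LA(6) LB(6) by blast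
  have yN: "y \<in> N" using y unfolding N_def by auto
  have yJ: "y \<notin> J" using yN NJ by blast
  \<comment> \<open>\<open>D\<close> is the inside or the outside of \<open>J\<close>, whichever does not contain \<open>N\<close>.\<close>
  obtain D where D: "connected D" "open D" "D \<noteq> {}" "D \<inter> N = {}" "frontier D = J" "D \<subseteq> - J"
     "y \<notin> D" "\<And>Y. connected Y \<Longrightarrow> Y \<inter> J = {} \<Longrightarrow> Y \<inter> D \<noteq> {} \<Longrightarrow> Y \<subseteq> D"
  proof -
    have one: "Y \<subseteq> inside J \<or> Y \<subseteq> outside J" if "connected Y" "Y \<inter> J = {}" for Y
    proof -
      have "Y \<subseteq> inside J \<union> outside J" using that sides(10) by blast
      moreover have "inside J \<inter> outside J \<inter> Y = {}" using sides(9) by blast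
      ultimately have "inside J \<inter> Y = {} \<or> outside J \<inter> Y = {}"
        using connectedD[OF that(1) sides(2) sides(6)] by blast
      then show ?thesis using \<open>Y \<subseteq> inside J \<union> outside J\<close> by blast
    qed
    show thesis
    proof (cases "N \<subseteq> inside J")
      case True
      show thesis
      proof (rule that[OF sides(7,6,5) _ sides(8)])
        show "outside J \<inter> N = {}" "y \<notin> outside J" "outside J \<subseteq> - J"
          using True sides(9,10) yN by blast+
        show "Y \<subseteq> outside J" if "connected Y" "Y \<inter> J = {}" "Y \<inter> outside J \<noteq> {}" for Y
          using one[OF that(1,2)] that(3) sides(9) by blast
      qed
    next
      case False
      then have out: "N \<subseteq> outside J" using one[OF Nconn NJ] by blast
      show thesis
      proof (rule that[OF sides(3,2,1) _ sides(4)])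
        show "inside J \<inter> N = {}" "y \<notin> inside J" "inside J \<subseteq> - J"
          using out sides(9,10) yN by blast+
        show "Y \<subseteq> inside J" if "connected Y" "Y \<inter> J = {}" "Y \<inter> inside J \<noteq> {}" for Y
          using one[OF that(1,2)] that(3) sides(9) by blast
      qed
    qed
  qed
  have "M \<subseteq> N \<union> J"
    unfolding M_def N_def J_def using LA(6) LB(6) by blast
  then have DST: "D \<inter> S = {}" "D \<inter> T = {}" using D(4,6) STU by blast+
  obtain z where z: "z \<in> D" using D(3) by blast
  have reach: "connected_component (- U) z p"
    if U: "closed U" "D \<inter> U = {}" and p: "p \<in> J" "p \<notin> U" for U p
  proof -
    obtain e where e: "0 < e" "ball p e \<subseteq> - U"
      using U(1) p(2) open_contains_ball[of "- U"] by (auto simp: open_Compl)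
    have "p \<in> closure D" using D(5) p(1) by (auto simp: frontier_def)
    then have "ball p e \<inter> D \<noteq> {}"
      using e(1) closure_iff_nhds_not_empty[of p D] by (metis centre_in_ball inf_commute open_ball subset_refl)
    then have "connected (D \<union> ball p e)" using D(1) by (intro connected_Un) auto
    moreover have "D \<union> ball p e \<subseteq> - U" using U e by auto
    ultimately show ?thesis
      unfolding connected_component_def using z e(1) by (intro exI[of _ "D \<union> ball p e"]) auto
  qed
  have p12J: "p1 \<in> J" "p2 \<in> J" using gi unfolding J_def by auto
  have "connected_component (- S) y z"
    using yp2 reach[OF compact_imp_closed[OF comp(1)] DST(1) p12J(2) p2S]
    by (meson connected_component_sym connected_component_trans)
  moreover have "connected_component (- T) y z"
    using yp1 reach[OF compact_imp_closed[OF comp(2)] DST(2) p12J(1) p1T]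
    by (meson connected_component_sym connected_component_trans)
  ultimately have "connected_component (- (S \<union> T)) y z"
    using Janiszewski[OF comp(1) compact_imp_closed[OF comp(2)]] ST M(1) by simp
  then obtain Y where Y: "connected Y" "Y \<subseteq> - (S \<union> T)" "y \<in> Y" "z \<in> Y"
    unfolding connected_component_def by blast
  then have "Y \<subseteq> D" using D(8)[of Y] STU z by blast
  then show False using Y D(7) by blast
qed

section \<open>Planar graphs have no K33 minor\<close>

lemma path_connected_arc_diff_end:
  fixes g :: "real \<Rightarrow> 'a::topological_space"
  assumes g: "arc g" and q: "q \<in> {pathstart g, pathfinish g}"
  shows "path_connected (path_image g - {q})"
proof -
  have inj: "inj_on g {0..1}" and cont: "continuous_on {0..1} g" using g by (auto simp: arc_def path_def)
  obtain I :: "real set" where I: "is_interval I" "I \<subseteq> {0..1}" "path_image g - {q} = g ` I"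
  proof (cases "q = g 0")
    case True
    have "path_image g - {q} = g ` ({0..1} - {0})"
      unfolding path_image_def True using inj_on_image_set_diff[OF inj, of "{0..1}" "{0}"] by simp
    also have "{0..1} - {0} = {0<..(1::real)}" by auto
    finally show thesis using that[of "{0<..1}"] by (simp add: is_interval_oc subset_eq)
  next
    case False
    then have q1: "q = g 1" using q by (auto simp: pathstart_def pathfinish_def)
    have "path_image g - {q} = g ` ({0..1} - {1})"
      unfolding path_image_def q1 using inj_on_image_set_diff[OF inj, of "{0..1}" "{1}"] by simp
    also have "{0..1} - {1} = {0..<(1::real)}" by auto
    finally show thesis using that[of "{0..<1}"] by (simp add: is_interval_co subset_eq)
  qed
  then show ?thesis
    using cont path_connected_continuous_image[of I g] continuous_on_subset
    by (metis is_interval_path_connected_1)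
qed

text \<open>
  In the drawing, a connected vertex set together with the three edges that lead to \<open>p1\<close>, \<open>p2\<close>, \<open>p3\<close>
  becomes one of the three sets of \<open>no_three_tripods\<close>. One side of the minor may consist of single vertices
  because the graph \<open>K\<^sub>3\<^sub>,\<^sub>3\<close> is cubic; this keeps the drawn sets disjoint apart from three points. Only arcs
  inside the drawn sets are used, so these need not be compact and the branch sets may be infinite.
\<close>

lemma no_K33_minor:
  assumes G: "simple_graph V E" and emb: "plane_embedding V E p \<gamma>"
    and sub: "A \<subseteq> V" "B \<subseteq> V" "C \<subseteq> V"
    and disj: "A \<inter> B = {}" "A \<inter> C = {}" "B \<inter> C = {}"
    and conn: "connected_in E A" "connected_in E B" "connected_in E C"
    and dist: "p1 \<noteq> p2" "p1 \<noteq> p3" "p2 \<noteq> p3"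
    and out: "{p1, p2, p3} \<inter> (A \<union> B \<union> C) = {}"
    and nbr: "\<And>Z v. Z \<in> {A, B, C} \<Longrightarrow> v \<in> {p1, p2, p3} \<Longrightarrow> \<exists>z\<in>Z. {z, v} \<in> E"
  shows False
proof -
  define Q where "Q = {p1, p2, p3}"
  have inj: "inj_on p V"
    and arc: "\<And>e. e \<in> E \<Longrightarrow> arc (\<gamma> e)"
    and ends: "\<And>e. e \<in> E \<Longrightarrow> {pathstart (\<gamma> e), pathfinish (\<gamma> e)} = p ` e"
    and vert: "\<And>e. e \<in> E \<Longrightarrow> path_image (\<gamma> e) \<inter> p ` V = p ` e"
    and cross: "\<And>e e'. e \<in> E \<Longrightarrow> e' \<in> E \<Longrightarrow> e \<noteq> e' \<Longrightarrow> path_image (\<gamma> e) \<inter> path_image (\<gamma> e') = p ` (e \<inter> e')"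
    using emb unfolding plane_embedding_def by blast+
  have EV: "e \<subseteq> V" if "e \<in> E" for e using G that by (auto simp: simple_graph_def)
  have QV: "Q \<subseteq> V" using nbr[of A] EV unfolding Q_def by blast
  have "\<exists>z. z \<in> Z \<and> {z, v} \<in> E" if "Z \<in> {A, B, C}" "v \<in> Q" for Z v
    using nbr[OF that(1), of v] that(2) unfolding Q_def by blast
  then obtain nb where nb: "\<And>Z v. Z \<in> {A, B, C} \<Longrightarrow> v \<in> Q \<Longrightarrow> nb Z v \<in> Z \<and> {nb Z v, v} \<in> E"
    by metis
  define EE where "EE = (\<lambda>Z. {e \<in> E. e \<subseteq> Z} \<union> (\<lambda>v. {nb Z v, v}) ` Q)"
  \<comment> \<open>\<open>EE Z\<close>: the edges inside \<open>Z\<close> and one edge to each of the three vertices; \<open>H Z\<close>: their drawing.\<close>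
  define H where "H = (\<lambda>Z. p ` Z \<union> (\<Union>e\<in>EE Z. path_image (\<gamma> e)))"
  have sep: "Z \<inter> Q = {}" "Z \<subseteq> V" if "Z \<in> {A, B, C}" for Z
    using that out sub unfolding Q_def by auto
  have EE: "e \<in> E" "e \<subseteq> Z \<union> Q" "e \<inter> Z \<noteq> {}" if "Z \<in> {A, B, C}" "e \<in> EE Z" for Z e
  proof -
    have "card e = 2" if "e \<in> E" for e using G that by (auto simp: simple_graph_def)
    then have ne: "e \<noteq> {}" if "e \<in> E" for e using that by force
    show "e \<in> E" "e \<subseteq> Z \<union> Q" using that nb[OF that(1)] unfolding EE_def by auto
    show "e \<inter> Z \<noteq> {}" using that nb[OF that(1)] ne unfolding EE_def by auto
  qed
  have HI: "H Z \<inter> H Z' \<subseteq> p ` Q" if Z: "Z \<in> {A, B, C}" "Z' \<in> {A, B, C}" "Z \<inter> Z' = {}" for Z Z'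
  proof -
    have 1: "p ` Z \<inter> p ` Z' = {}" using inj_on_image_Int[OF inj, of Z Z'] Z sep by auto
    have 2: "p ` Y \<inter> path_image (\<gamma> e) \<subseteq> p ` Q"
      if "Y \<in> {A, B, C}" "Y' \<in> {A, B, C}" "Y \<inter> Y' = {}" "e \<in> EE Y'" for Y Y' e
    proof -
      have "p ` Y \<inter> path_image (\<gamma> e) \<subseteq> p ` Y \<inter> p ` e"
        using vert[OF EE(1)[OF that(2,4)]] sep(2)[OF that(1)] by blast
      also have "\<dots> = p ` (Y \<inter> e)"
        using inj_on_image_Int[OF inj, of Y e] sep(2)[OF that(1)] EV EE(1)[OF that(2,4)] by simp
      also have "\<dots> \<subseteq> p ` Q" using EE(2)[OF that(2,4)] that(3) by blast
      finally show ?thesis .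
    qed
    have 3: "path_image (\<gamma> e) \<inter> path_image (\<gamma> e') \<subseteq> p ` Q" if "e \<in> EE Z" "e' \<in> EE Z'" for e e'
    proof -
      note e = EE[OF Z(1) that(1)] and e' = EE[OF Z(2) that(2)]
      have "e \<noteq> e'" using e e' Z(3) sep(1)[OF Z(1)] by blast
      then show ?thesis using cross[OF e(1) e'(1)] e(2) e'(2) Z(3) by blast
    qed
    have 4: "p ` Z' \<inter> path_image (\<gamma> e) \<subseteq> p ` Q" if "e \<in> EE Z" for e
      using 2[OF Z(2,1) _ that] Z(3) by blast
    show ?thesis
    proof
      fix y assume "y \<in> H Z \<inter> H Z'"
      then have "y \<in> p ` Z \<or> (\<exists>e\<in>EE Z. y \<in> path_image (\<gamma> e))" "y \<in> p ` Z' \<or> (\<exists>e\<in>EE Z'. y \<in> path_image (\<gamma> e))"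
        unfolding H_def by simp_all
      then show "y \<in> p ` Q" by (meson 1 2[OF Z] 3 4 IntI disjoint_iff subsetD)
    qed
  qed
  have HQ: "p ` Q \<subseteq> H Z" if Z: "Z \<in> {A, B, C}" for Z
  proof
    fix y assume "y \<in> p ` Q"
    then obtain v where v: "v \<in> Q" "y = p v" by blast
    have "{nb Z v, v} \<in> EE Z" using v unfolding EE_def by blast
    moreover have "p v \<in> path_image (\<gamma> {nb Z v, v})"
      using vert[of "{nb Z v, v}"] nb[OF Z v(1)] by blast
    ultimately show "y \<in> H Z" using v unfolding H_def by blast
  qed
  have Hconn: "path_connected (H Z - F)" if Z: "Z \<in> {A, B, C}" and F: "F \<subset> p ` Q" for Z F
  proof -
    have Zc: "connected_in E Z" using Z conn by auto
    define base where "base = p (nb Z p1)"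
    have inF: "p a \<notin> F" if "a \<in> Z" for a
    proof -
      have "p a \<notin> p ` Q" using that sep[OF Z] QV inj by (auto dest!: inj_onD)
      then show ?thesis using F by blast
    qed
    have b0: "nb Z p1 \<in> Z" using nb[OF Z, of p1] by (simp add: Q_def)
    \<comment> \<open>Only the three extra edges contain points of \<open>F\<close>, each of them at most its own endpoint.\<close>
    have edge_sub: "path_image (\<gamma> e) \<subseteq> H Z - F" if "e \<in> E" "e \<subseteq> Z" for e
    proof -
      have "path_image (\<gamma> e) \<inter> p ` Q \<subseteq> p ` e \<inter> p ` Q" using vert[OF that(1)] QV by blast
      also have "\<dots> = p ` (e \<inter> Q)" using inj_on_image_Int[OF inj, of e Q] EV[OF that(1)] QV by simp
      also have "\<dots> = {}" using that(2) sep(1)[OF Z] by blast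
      finally show ?thesis using that F unfolding H_def EE_def by blast
    qed
    have verts: "path_component (H Z - F) base (p a)" if "a \<in> Z" for a
    proof -
      have "joined E Z (nb Z p1) a" using Zc b0 that by (auto simp: connected_in_def)
      then show ?thesis
      proof (induction rule: joined_induct)
        case refl
        then show ?case using inF[OF b0] b0 unfolding base_def H_def by (auto intro: path_component_refl)
      next
        case (step b c)
        have "path_component (path_image (\<gamma> {b, c})) (p b) (p c)"
          using path_connected_path_image[OF arc_imp_path[OF arc[OF step(4)]]] vert[OF step(4)]
          unfolding path_connected_component by blast
        then have "path_component (H Z - F) (p b) (p c)"
          using path_component_of_subset[OF edge_sub[of "{b, c}"]] step by simp
        then show ?case using step path_component_trans by metis
      qed
    qed
    have reach: "path_component (H Z - F) base y" if y: "y \<in> H Z - F" for y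
    proof -
      consider (vertex) a where "a \<in> Z" "y = p a"
        | (edge) e where "e \<in> E" "e \<subseteq> Z" "y \<in> path_image (\<gamma> e)"
        | (leg) v where "v \<in> Q" "y \<in> path_image (\<gamma> {nb Z v, v})"
        using y unfolding H_def EE_def by blast
      then show ?thesis
      proof cases
        case vertex
        then show ?thesis using verts by simp
      next
        case edge
        obtain a where a: "a \<in> e" using EE(3)[OF Z, of e] edge unfolding EE_def by blast
        have "path_component (path_image (\<gamma> e)) (p a) y"
          using path_connected_path_image[OF arc_imp_path[OF arc[OF edge(1)]]] vert[OF edge(1)] a edge(3)
          unfolding path_connected_component by blast
        then have "path_component (H Z - F) (p a) y"
          using path_component_of_subset[OF edge_sub[OF edge(1,2)]] by simp
        then show ?thesis using verts a edge(2) path_component_trans by blast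
      next
        case leg
        define e where "e = {nb Z v, v}"
        have e: "e \<in> E" "e \<in> EE Z" using nb[OF Z leg(1)] leg(1) unfolding e_def EE_def by auto
        define K where "K = path_image (\<gamma> e) - (F \<inter> {p v})"
        have "path_image (\<gamma> e) \<inter> p ` Q \<subseteq> p ` e \<inter> p ` Q" using vert[OF e(1)] QV by blast
        also have "\<dots> = p ` (e \<inter> Q)" using inj_on_image_Int[OF inj, of e Q] EV[OF e(1)] QV by simp
        also have "\<dots> \<subseteq> {p v}" using nb[OF Z leg(1)] sep(1)[OF Z] unfolding e_def by auto
        finally have K1: "K = path_image (\<gamma> e) - F" unfolding K_def using F by blast
        then have K2: "K \<subseteq> H Z - F" using e(2) unfolding H_def by blast
        have "path_connected K"
        proof (cases "p v \<in> F")
          case False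
          then show ?thesis unfolding K_def using arc[OF e(1)] by (simp add: path_connected_path_image arc_imp_path)
        next
          case True
          have "p v \<in> {pathstart (\<gamma> e), pathfinish (\<gamma> e)}" using ends[OF e(1)] unfolding e_def by auto
          then have "path_connected (path_image (\<gamma> e) - {p v})"
            using arc[OF e(1)] path_connected_arc_diff_end by auto
          then show ?thesis unfolding K_def using True by simp
        qed
        moreover have "p (nb Z v) \<in> K"
          unfolding K1 using vert[OF e(1)] inF nb[OF Z leg(1)] unfolding e_def by blast
        moreover have "y \<in> K" unfolding K1 using leg y e_def by blast
        ultimately have "path_component K (p (nb Z v)) y" unfolding path_connected_component by blast
        then have "path_component (H Z - F) (p (nb Z v)) y" using path_component_of_subset[OF K2] by simp
        then show ?thesis using verts[of "nb Z v"] nb[OF Z leg(1)] path_component_trans by blast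
      qed
    qed
    show ?thesis
      unfolding path_connected_component using reach path_component_sym path_component_trans by metis
  qed
  have pQ: "p ` Q = {p p1, p p2, p p3}" unfolding Q_def by simp
  show False
  proof (rule no_three_tripods[of "p p1" "p p2" "p p3" "H A" "H B" "H C"])
    show "p p1 \<noteq> p p2" "p p1 \<noteq> p p3" "p p2 \<noteq> p p3"
      using dist QV inj unfolding Q_def by (auto dest: inj_onD)
    show "\<And>Z F. Z \<in> {H A, H B, H C} \<Longrightarrow> F \<subset> {p p1, p p2, p p3} \<Longrightarrow> path_connected (Z - F)"
      using Hconn pQ by auto
  qed (use HI HQ disj pQ in auto)
qed

section \<open>Paths as lists, and the decomposition of a flow\<close>

definition steps :: "'a list \<Rightarrow> ('a \<times> 'a) set" where
  "steps P = set (zip P (tl P))"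

lemma steps_simps [simp]:
  "steps [] = {}" "steps [a] = {}" "steps (a # b # P) = insert (a, b) (steps (b # P))"
  by (auto simp: steps_def)

lemma finite_steps [simp]: "finite (steps P)"
  by (simp add: steps_def)

lemma steps_butlast_tl: "(a, b) \<in> steps P \<Longrightarrow> a \<in> set (butlast P) \<and> b \<in> set (tl P)"
  by (induction P rule: induct_list012) auto

lemma steps_subset: "(a, b) \<in> steps P \<Longrightarrow> a \<in> set P \<and> b \<in> set P"
  using steps_butlast_tl in_set_butlastD list.set_sel(2) by (metis butlast.simps(1) empty_iff list.set(1))

lemma sum_steps_out:
  assumes "distinct P" "finite U" "set P \<subseteq> U"
  shows "(\<Sum>b\<in>U. of_bool ((a, b) \<in> steps P)) = (of_bool (a \<in> set (butlast P)) :: real)"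
  using assms
proof (induction P rule: induct_list012)
  case (3 u v Q)
  show ?case
  proof (cases "a = u")
    case True
    then have "(a, b) \<notin> steps (v # Q)" for b using 3(3) steps_subset[of a b "v # Q"] by auto
    then have "(\<Sum>b\<in>U. of_bool ((a, b) \<in> steps (u # v # Q))) = (\<Sum>b\<in>U. if b = v then 1 else 0 :: real)"
      using True by (intro sum.cong) auto
    then show ?thesis using True 3(4,5) by simp
  next
    case False
    then show ?thesis using 3 by simp
  qed
qed auto

lemma sum_steps_in:
  assumes "distinct P" "finite U" "set P \<subseteq> U"
  shows "(\<Sum>b\<in>U. of_bool ((b, a) \<in> steps P)) = (of_bool (a \<in> set (tl P)) :: real)"
  using assms
proof (induction P rule: induct_list012)
  case (3 u v Q)
  have IH: "(\<Sum>b\<in>U. of_bool ((b, a) \<in> steps (v # Q))) = (of_bool (a \<in> set Q) :: real)"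
    using 3 by simp
  show ?case
  proof (cases "a = v")
    case True
    then have "(b, a) \<notin> steps (v # Q)" for b using 3(3) steps_butlast_tl[of b a "v # Q"] by auto
    then have "(\<Sum>b\<in>U. of_bool ((b, a) \<in> steps (u # v # Q))) = (\<Sum>b\<in>U. if b = u then 1 else 0 :: real)"
      using True by (intro sum.cong) auto
    then show ?thesis using True 3(4,5) by simp
  next
    case False
    then show ?thesis using IH by simp
  qed
qed auto

lemma butlast_steps: "a \<in> set (butlast P) \<Longrightarrow> \<exists>b. (a, b) \<in> steps P"
  by (induction P rule: induct_list012) auto

lemma tl_steps: "a \<in> set (tl P) \<Longrightarrow> \<exists>b. (b, a) \<in> steps P"
proof (induction P rule: induct_list012)
  case (3 u v Q)
  then show ?case by (cases "a = v") auto
qed auto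

lemma successively_iff_steps: "successively R L \<longleftrightarrow> (\<forall>(a, b)\<in>steps L. R a b)"
  by (induction L rule: induct_list012) auto

definition path_edges :: "'b list \<Rightarrow> 'b set set" where
  "path_edges P = (\<lambda>(a, b). {a, b}) ` steps P"

lemma path_edges_simps [simp]:
  "path_edges [] = {}" "path_edges [a] = {}" "path_edges (a # b # P) = insert {a, b} (path_edges (b # P))"
  by (auto simp: path_edges_def)

lemma finite_path_edges [simp]: "finite (path_edges P)"
  by (simp add: path_edges_def)

lemma path_edges_vertices: "e \<in> path_edges P \<Longrightarrow> e \<subseteq> set P"
  unfolding path_edges_def using steps_subset by fastforce

definition exit_path :: "('a \<Rightarrow> 'a \<Rightarrow> real) \<Rightarrow> 'a set \<Rightarrow> 'a \<Rightarrow> 'a list \<Rightarrow> bool" where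
  "exit_path \<theta> W x P \<longleftrightarrow> P \<noteq> [] \<and> distinct P \<and> hd P = x \<and> last P \<notin> W \<and> set (butlast P) \<subseteq> W \<and>
     (\<forall>(a, b)\<in>steps P. 0 < \<theta> a b)"

lemma rtrancl_path_steps: "rtrancl_path r x xs y \<Longrightarrow> (a, b) \<in> steps (x # xs) \<Longrightarrow> r a b"
  by (induction rule: rtrancl_path.induct) auto

text \<open>
  Otherwise the set of vertices reachable from \<open>x\<close> along positive values would stay in \<open>W\<close>; its net outflow
  would be positive because of \<open>x\<close>, although nothing flows out of it.
\<close>

lemma exit_path_exists:
  fixes \<theta> :: "'a \<Rightarrow> 'a \<Rightarrow> real"
  assumes fin: "finite W" "finite U" and WU: "W \<subseteq> U" and x: "x \<in> W"
    and anti: "\<And>a b. \<theta> a b = - \<theta> b a"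
    and div: "\<And>a. a \<in> W \<Longrightarrow> a \<noteq> x \<Longrightarrow> (\<Sum>b\<in>U. \<theta> a b) = 0" "0 < (\<Sum>b\<in>U. \<theta> x b)"
  shows "\<exists>P. exit_path \<theta> W x P"
proof -
  define r where "r = (\<lambda>a b. a \<in> W \<and> 0 < \<theta> a b)"
  define R where "R = {b. r\<^sup>*\<^sup>* x b}"
  have "\<not> R \<subseteq> W"
  proof
    assume RW: "R \<subseteq> W"
    have finR: "finite R" using RW fin(1) finite_subset by blast
    have xR: "x \<in> R" unfolding R_def by simp
    have "(\<Sum>a\<in>R. \<Sum>b\<in>U. \<theta> a b) = (\<Sum>a\<in>R. if a = x then (\<Sum>b\<in>U. \<theta> x b) else 0)"
      using RW div(1) by (intro sum.cong) auto
    then have pos: "0 < (\<Sum>a\<in>R. \<Sum>b\<in>U. \<theta> a b)" using finR xR div(2) by simp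
    have "(\<Sum>a\<in>R. \<Sum>b\<in>R. \<theta> a b) = (\<Sum>a\<in>R. \<Sum>b\<in>R. - \<theta> b a)"
      by (intro sum.cong anti refl)
    also have "\<dots> = - (\<Sum>a\<in>R. \<Sum>b\<in>R. \<theta> a b)"
      by (subst sum.swap) (simp add: sum_negf)
    finally have inner: "(\<Sum>a\<in>R. \<Sum>b\<in>R. \<theta> a b) = 0" by simp
    have outer: "\<theta> a b \<le> 0" if "a \<in> R" "b \<in> U - R" for a b
    proof (rule ccontr)
      assume "\<not> \<theta> a b \<le> 0"
      then have "r a b" using that RW unfolding r_def by auto
      then show False using that unfolding R_def by (auto intro: rtranclp.rtrancl_into_rtrancl)
    qed
    have "(\<Sum>b\<in>U. \<theta> a b) = (\<Sum>b\<in>R. \<theta> a b) + (\<Sum>b\<in>U - R. \<theta> a b)" for a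
      using sum.subset_diff[of R U "\<theta> a"] RW WU fin by (simp add: subset_trans)
    then have "(\<Sum>a\<in>R. \<Sum>b\<in>U. \<theta> a b) = (\<Sum>a\<in>R. \<Sum>b\<in>U - R. \<theta> a b)"
      using inner by (simp add: sum.distrib)
    also have "\<dots> \<le> 0" using outer by (intro sum_nonpos) auto
    finally show False using pos by simp
  qed
  then obtain y where y: "y \<notin> W" "r\<^sup>*\<^sup>* x y" unfolding R_def by blast
  then obtain xs0 where "rtrancl_path r x xs0 y" using rtranclp_eq_rtrancl_path[of r x y] by blast
  then obtain xs where xs: "rtrancl_path r x xs y" "distinct (x # xs)" using rtrancl_path_distinct by metis
  have ne: "xs \<noteq> []" using xs(1) y(1) x by (auto elim: rtrancl_path.cases)
  have r: "r a b" if "(a, b) \<in> steps (x # xs)" for a b using rtrancl_path_steps[OF xs(1) that] .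
  have "exit_path \<theta> W x (x # xs)"
    unfolding exit_path_def
  proof (intro conjI)
    show "last (x # xs) \<notin> W" using rtrancl_path_last[OF xs(1) ne] ne y(1) by simp
    show "set (butlast (x # xs)) \<subseteq> W" using butlast_steps r unfolding r_def by fastforce
    show "\<forall>(a, b)\<in>steps (x # xs). 0 < \<theta> a b" using r unfolding r_def by auto
  qed (use xs(2) in auto)
  then show ?thesis by blast
qed

text \<open>
  Subtract along an exit path as much as the smallest value on it or the remaining source strength
  permits; this removes a positive value or exhausts the source. The values of the flow only decrease in
  modulus, so the weights of the paths through an arc never exceed the original value there. The set \<open>U\<close>
  collects the ends of the arcs that leave \<open>W\<close>, which makes the divergence a finite sum.
\<close>

lemma flow_path_decomposition:
  fixes \<theta> :: "'a \<Rightarrow> 'a \<Rightarrow> real"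
  assumes fin: "finite W" "finite U" and WU: "W \<subseteq> U" and x: "x \<in> W"
    and "\<And>a b. \<theta> a b = - \<theta> b a"
    and "\<And>a b. a \<in> W \<Longrightarrow> \<theta> a b \<noteq> 0 \<Longrightarrow> b \<in> U"
    and "\<And>a. a \<in> W \<Longrightarrow> a \<noteq> x \<Longrightarrow> (\<Sum>b\<in>U. \<theta> a b) = 0"
    and "(\<Sum>b\<in>U. \<theta> x b) = \<kappa>" "0 \<le> \<kappa>"
  shows "\<exists>PP c. finite PP \<and> (\<forall>P\<in>PP. exit_path \<theta> W x P) \<and> (\<forall>P. 0 \<le> c P) \<and> sum c PP = \<kappa> \<and>
     (\<forall>a b. (\<Sum>P | P \<in> PP \<and> (a, b) \<in> steps P. c P) \<le> max 0 (\<theta> a b))"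
  using assms(5-)
proof (induction "card {(a, b). a \<in> W \<and> b \<in> U \<and> 0 < \<theta> a b}" arbitrary: \<theta> \<kappa> rule: less_induct)
  case less
  note anti = less(2) and supp = less(3) and div = less(4) and divx = less(5)
  show ?case
  proof (cases "\<kappa> = 0")
    case True
    then show ?thesis by (intro exI[of _ "{}"] exI[of _ "\<lambda>_. 0"]) auto
  next
    case False
    then have \<kappa>: "0 < \<kappa>" using less(6) by simp
    obtain P where P: "exit_path \<theta> W x P"
      using exit_path_exists[OF fin WU x anti div] divx \<kappa> by auto
    have Ppos: "0 < \<theta> a b" if "(a, b) \<in> steps P" for a b using P that unfolding exit_path_def by blast
    have asym: "(b, a) \<notin> steps P" if "(a, b) \<in> steps P" for a b
      using Ppos[OF that] Ppos[of b a] anti[of a b] by auto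
    have P2: "distinct P" "hd P = x" "last P \<notin> W" "set (butlast P) \<subseteq> W" "P \<noteq> []"
      using P unfolding exit_path_def by auto
    have tlne: "tl P \<noteq> []" using P2 x by (cases P) auto
    have ne: "steps P \<noteq> {}" using tlne by (cases P; cases "tl P") auto
    define \<delta> where "\<delta> = min \<kappa> (Min ((\<lambda>(a, b). \<theta> a b) ` steps P))"
    have \<delta>: "0 < \<delta>" "\<delta> \<le> \<kappa>" unfolding \<delta>_def using \<kappa> ne Ppos by auto
    have \<delta>le: "\<delta> \<le> \<theta> a b" if "(a, b) \<in> steps P" for a b
    proof -
      have "Min ((\<lambda>(a, b). \<theta> a b) ` steps P) \<le> \<theta> a b" using that by (intro Min_le) force+
      then show ?thesis unfolding \<delta>_def by simp
    qed
    have PU: "set P \<subseteq> U"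
    proof
      fix b assume b: "b \<in> set P"
      show "b \<in> U"
      proof (cases "b \<in> set (tl P)")
        case True
        then obtain a where a: "(a, b) \<in> steps P" using tl_steps by fast
        then have "a \<in> W" using steps_butlast_tl P2(4) by fast
        then show ?thesis using supp[of a b] Ppos[OF a] by simp
      next
        case False
        then have "b = x" using b P2(2,5) by (cases P) auto
        then show ?thesis using x WU by auto
      qed
    qed
    \<comment> \<open>The unit flow along \<open>P\<close>, scaled by \<open>\<delta>\<close>, is removed in both orientations, to keep antisymmetry.\<close>
    define \<theta>' where "\<theta>' = (\<lambda>a b. \<theta> a b - \<delta> * (of_bool ((a, b) \<in> steps P) - of_bool ((b, a) \<in> steps P)))"
    have val: "\<theta>' a b = (if (a, b) \<in> steps P then \<theta> a b - \<delta> else if (b, a) \<in> steps P then \<theta> a b + \<delta> else \<theta> a b)" for a b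
      using asym[of a b] by (auto simp: \<theta>'_def)
    have le0: "\<theta>' a b \<le> 0" if "(b, a) \<in> steps P" for a b
      using that asym[OF that] \<delta>le[OF that] anti[of a b] unfolding val by auto
    have pos: "0 < \<theta> a b" if "0 < \<theta>' a b" for a b
      using that le0[of b a] \<delta>(1) Ppos[of a b] unfolding val by (auto split: if_splits)
    have anti': "\<theta>' a b = - \<theta>' b a" for a b using anti[of a b] unfolding \<theta>'_def by (simp add: algebra_simps)
    have div': "(\<Sum>b\<in>U. \<theta>' a b) = (\<Sum>b\<in>U. \<theta> a b) - \<delta> * of_bool (a = x)" if "a \<in> W" for a
    proof -
      have "(\<Sum>b\<in>U. \<theta>' a b) = (\<Sum>b\<in>U. \<theta> a b) - \<delta> * (of_bool (a \<in> set (butlast P)) - of_bool (a \<in> set (tl P)))"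
        unfolding \<theta>'_def sum_subtractf sum_distrib_left[symmetric]
        by (simp add: sum_steps_out[OF P2(1) fin(2) PU] sum_steps_in[OF P2(1) fin(2) PU])
      moreover have "a \<in> set (butlast P) \<longleftrightarrow> a \<in> set P"
        using that P2(3,5) by (metis Un_iff append_butlast_last_id set_append empty_iff list.set(1) set_ConsD)
      moreover have "a \<in> set (tl P) \<longleftrightarrow> a \<in> set P \<and> a \<noteq> x"
        using P2(1,2,5) by (cases P) auto
      moreover have "x \<in> set P" using P2(2,5) by auto
      ultimately show ?thesis by auto
    qed
    show ?thesis
    proof (cases "\<delta> = \<kappa>")
      case True
      show ?thesis
      proof (intro exI[of _ "{P}"] exI[of _ "\<lambda>_. \<kappa>"] conjI allI)
        fix a b
        show "(\<Sum>Q | Q \<in> {P} \<and> (a, b) \<in> steps Q. \<kappa>) \<le> max 0 (\<theta> a b)"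
        proof (cases "(a, b) \<in> steps P")
          case in_steps: True
          then have "{Q. Q \<in> {P} \<and> (a, b) \<in> steps Q} = {P}" by blast
          then have "(\<Sum>Q | Q \<in> {P} \<and> (a, b) \<in> steps Q. \<kappa>) = \<kappa>" by simp
          then show ?thesis using \<delta>le[OF in_steps] True by linarith
        next
          case False
          then have "{Q. Q \<in> {P} \<and> (a, b) \<in> steps Q} = {}" by blast
          then have "(\<Sum>Q | Q \<in> {P} \<and> (a, b) \<in> steps Q. \<kappa>) = 0" by (simp only: sum.empty)
          then show ?thesis by linarith
        qed
      qed (use P \<kappa> in simp_all)
    next
      case False
      then have "\<delta> = Min ((\<lambda>(a, b). \<theta> a b) ` steps P)" unfolding \<delta>_def by auto
      then have "\<delta> \<in> (\<lambda>(a, b). \<theta> a b) ` steps P" using ne Min_in[of "(\<lambda>(a, b). \<theta> a b) ` steps P"] by simp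
      then obtain a0 b0 where ab0: "(a0, b0) \<in> steps P" "\<theta> a0 b0 = \<delta>" by auto
      have a0W: "a0 \<in> W" using steps_butlast_tl[OF ab0(1)] P2(4) by auto
      have less_card: "card {(a, b). a \<in> W \<and> b \<in> U \<and> 0 < \<theta>' a b} < card {(a, b). a \<in> W \<and> b \<in> U \<and> 0 < \<theta> a b}"
      proof (rule psubset_card_mono)
        show "finite {(a, b). a \<in> W \<and> b \<in> U \<and> 0 < \<theta> a b}"
          by (rule finite_subset[of _ "W \<times> U"]) (use fin in auto)
        have "(a0, b0) \<in> {(a, b). a \<in> W \<and> b \<in> U \<and> 0 < \<theta> a b}"
          using a0W ab0 \<delta>(1) steps_subset[OF ab0(1)] PU by auto
        moreover have "(a0, b0) \<notin> {(a, b). a \<in> W \<and> b \<in> U \<and> 0 < \<theta>' a b}" using ab0 by (simp add: val)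
        ultimately show "{(a, b). a \<in> W \<and> b \<in> U \<and> 0 < \<theta>' a b} \<subset> {(a, b). a \<in> W \<and> b \<in> U \<and> 0 < \<theta> a b}"
          using pos by blast
      qed
      have supp': "b \<in> U" if "a \<in> W" "\<theta>' a b \<noteq> 0" for a b
      proof (cases "\<theta> a b = 0")
        case True
        then have "(a, b) \<in> steps P \<or> (b, a) \<in> steps P" using that(2) by (auto simp: val split: if_splits)
        then show ?thesis using steps_subset PU by fastforce
      next
        case False
        then show ?thesis using supp that(1) by blast
      qed
      have div0: "(\<Sum>b\<in>U. \<theta>' a b) = 0" if "a \<in> W" "a \<noteq> x" for a
        using div'[OF that(1)] div[OF that] that(2) by simp
      have divx': "(\<Sum>b\<in>U. \<theta>' x b) = \<kappa> - \<delta>" using div'[OF x] divx by simp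
      have nn: "0 \<le> \<kappa> - \<delta>" using \<delta>(2) by simp
      have "\<exists>PP c. finite PP \<and> (\<forall>Q\<in>PP. exit_path \<theta>' W x Q) \<and> (\<forall>Q. 0 \<le> c Q) \<and> sum c PP = \<kappa> - \<delta> \<and>
         (\<forall>a b. (\<Sum>Q | Q \<in> PP \<and> (a, b) \<in> steps Q. c Q) \<le> max 0 (\<theta>' a b))"
        by (rule less(1)[OF less_card]) (fact anti', fact supp', fact div0, fact divx', fact nn)
      then obtain PP c where IH: "finite PP" "\<forall>Q\<in>PP. exit_path \<theta>' W x Q" "\<forall>Q. 0 \<le> c Q" "sum c PP = \<kappa> - \<delta>"
         "\<forall>a b. (\<Sum>Q | Q \<in> PP \<and> (a, b) \<in> steps Q. c Q) \<le> max 0 (\<theta>' a b)"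
        by (elim exE conjE) (rule that; assumption)
      define c' where "c' = (\<lambda>Q. (if Q \<in> PP then c Q else 0) + (if Q = P then \<delta> else 0))"
      have sumc': "(\<Sum>Q | Q \<in> insert P PP \<and> A Q. c' Q) = (\<Sum>Q | Q \<in> PP \<and> A Q. c Q) + (if A P then \<delta> else 0)" for A
      proof -
        have f: "finite {Q. Q \<in> insert P PP \<and> A Q}" using IH(1) by simp
        have "(\<Sum>Q | Q \<in> insert P PP \<and> A Q. c' Q) =
            (\<Sum>Q | Q \<in> insert P PP \<and> A Q. if Q \<in> PP then c Q else 0) + (\<Sum>Q | Q \<in> insert P PP \<and> A Q. if Q = P then \<delta> else 0)"
          unfolding c'_def by (rule sum.distrib)
        also have "(\<Sum>Q | Q \<in> insert P PP \<and> A Q. if Q \<in> PP then c Q else 0) = (\<Sum>Q | Q \<in> PP \<and> A Q. c Q)"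
          by (rule sum.mono_neutral_cong_right[OF f]) auto
        also have "(\<Sum>Q | Q \<in> insert P PP \<and> A Q. if Q = P then \<delta> else 0) = (if A P then \<delta> else 0)"
          using f by (simp add: sum.delta)
        finally show ?thesis .
      qed
      show ?thesis
      proof (intro exI[of _ "insert P PP"] exI[of _ c'] conjI allI)
        show "finite (insert P PP)" using IH(1) by simp
        show "\<forall>Q\<in>insert P PP. exit_path \<theta> W x Q"
          using P IH(2) pos unfolding exit_path_def by fast
        show "0 \<le> c' Q" for Q using IH(3) \<delta>(1) by (simp add: c'_def)
        show "sum c' (insert P PP) = \<kappa>" using sumc'[of "\<lambda>_. True"] IH(4) by (simp del: insert_iff)
        fix a b
        have "(\<Sum>Q | Q \<in> insert P PP \<and> (a, b) \<in> steps Q. c' Q) \<le> max 0 (\<theta>' a b) + (if (a, b) \<in> steps P then \<delta> else 0)"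
          unfolding sumc' using IH(5) by simp
        also have "\<dots> \<le> max 0 (\<theta> a b)"
          using \<delta>le[of a b] pos[of a b] le0[of b a] unfolding val by (auto split: if_splits)
        finally show "(\<Sum>Q | Q \<in> insert P PP \<and> (a, b) \<in> steps Q. c' Q) \<le> max 0 (\<theta> a b)" .
      qed
    qed
  qed
qed

section \<open>Averages over weighted families\<close>

text \<open>
  If \<open>c\<close> is the distribution of a random finite set \<open>S P\<close> that contains \<open>i\<close> with probability at most \<open>w i\<close>,
  then the expected \<open>\<rho>\<close>-weight of the random set is at most the sum of \<open>\<rho> i * w i\<close>.
\<close>

lemma expected_sum_le:
  fixes c :: "'p \<Rightarrow> real" and S :: "'p \<Rightarrow> 'i set"
  assumes PP: "finite PP" and S: "\<And>P. P \<in> PP \<Longrightarrow> finite (S P)"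
    and w: "\<And>i. i \<in> (\<Union>P\<in>PP. S P) \<Longrightarrow> (\<Sum>P | P \<in> PP \<and> i \<in> S P. c P) \<le> w i" and \<rho>: "\<And>i. 0 \<le> \<rho> i"
  shows "(\<Sum>P\<in>PP. c P * (\<Sum>i\<in>S P. \<rho> i)) \<le> (\<Sum>i\<in>(\<Union>P\<in>PP. S P). \<rho> i * w i)"
proof -
  define I where "I = (\<Union>P\<in>PP. S P)"
  have I: "finite I" unfolding I_def using PP S by auto
  have "(\<Sum>P\<in>PP. c P * (\<Sum>i\<in>S P. \<rho> i)) = (\<Sum>P\<in>PP. \<Sum>i\<in>{i \<in> I. i \<in> S P}. c P * \<rho> i)"
  proof (rule sum.cong)
    fix P assume "P \<in> PP"
    then have "{i \<in> I. i \<in> S P} = S P" unfolding I_def by auto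
    then show "c P * (\<Sum>i\<in>S P. \<rho> i) = (\<Sum>i\<in>{i \<in> I. i \<in> S P}. c P * \<rho> i)" by (simp add: sum_distrib_left)
  qed simp
  also have "\<dots> = (\<Sum>i\<in>I. \<Sum>P\<in>{P \<in> PP. i \<in> S P}. c P * \<rho> i)"
    by (rule sum.swap_restrict[OF PP I])
  also have "\<dots> = (\<Sum>i\<in>I. \<rho> i * (\<Sum>P | P \<in> PP \<and> i \<in> S P. c P))"
    by (simp add: sum_distrib_left mult.commute)
  also have "\<dots> \<le> (\<Sum>i\<in>I. \<rho> i * w i)"
    using w \<rho> by (intro sum_mono mult_left_mono) (auto simp: I_def)
  finally show ?thesis unfolding I_def .
qed

text \<open>
  The first moment method for three independent samples with an individual cost \<open>g\<close> and a pair cost \<open>a\<close>: the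
  expected total cost is at most \<open>3 * s + 3 * t\<close>.
\<close>

lemma exists_cheap_triple:
  fixes c g :: "'p \<Rightarrow> real" and a :: "'p \<Rightarrow> 'p \<Rightarrow> real"
  assumes c: "\<And>P. 0 \<le> c P" "sum c PP = 1"
    and g: "(\<Sum>P\<in>PP. c P * g P) \<le> s" and a: "(\<Sum>P\<in>PP. \<Sum>Q\<in>PP. c P * c Q * a P Q) \<le> t"
    and st: "3 * s + 3 * t < 1"
  shows "\<exists>P\<in>PP. \<exists>Q\<in>PP. \<exists>R\<in>PP. g P + g Q + g R + a P Q + a P R + a Q R < 1"
proof (rule ccontr)
  assume "\<not> ?thesis"
  then have ge: "1 \<le> g P + g Q + g R + a P Q + a P R + a Q R" if "P \<in> PP" "Q \<in> PP" "R \<in> PP" for P Q R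
    using that by (meson not_le)
  define G where "G = (\<Sum>P\<in>PP. c P * g P)"
  define r where "r = (\<lambda>P. \<Sum>Q\<in>PP. c Q * a P Q)"
  define A where "A = (\<Sum>P\<in>PP. c P * r P)"
  have A: "A = (\<Sum>P\<in>PP. \<Sum>Q\<in>PP. c P * c Q * a P Q)"
    unfolding A_def r_def by (simp add: sum_distrib_left mult.assoc)
  have const: "(\<Sum>P\<in>PP. c P * k) = k" for k using c(2) by (simp flip: sum_distrib_right)
  have inner: "(\<Sum>R\<in>PP. c R * (g P + g Q + g R + a P Q + a P R + a Q R)) = g P + g Q + G + a P Q + r P + r Q" for P Q
    by (simp only: distrib_left sum.distrib const flip: G_def) (simp add: r_def)
  have middle: "(\<Sum>Q\<in>PP. c Q * (g P + g Q + G + a P Q + r P + r Q)) = g P + G + G + r P + r P + A" for P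
    by (simp only: distrib_left sum.distrib const flip: G_def A_def) (simp add: r_def)
  have outer: "(\<Sum>P\<in>PP. c P * (g P + G + G + r P + r P + A)) = 3 * G + 3 * A"
    by (simp only: distrib_left sum.distrib const flip: G_def A_def)
  have "1 = (\<Sum>P\<in>PP. c P * (\<Sum>Q\<in>PP. c Q * (\<Sum>R\<in>PP. c R * 1)))"
    using c(2) by (simp flip: sum_distrib_right)
  also have "\<dots> \<le> (\<Sum>P\<in>PP. c P * (\<Sum>Q\<in>PP. c Q * (\<Sum>R\<in>PP. c R * (g P + g Q + g R + a P Q + a P R + a Q R))))"
    by (intro sum_mono mult_left_mono c ge)
  also have "\<dots> = 3 * G + 3 * A" unfolding inner middle outer ..
  also have "\<dots> \<le> 3 * s + 3 * t" using g a unfolding G_def A by simp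
  finally show False using st by simp
qed

section \<open>Gradients and energy\<close>

lemma sum_square_summable:
  fixes a b :: "'b \<Rightarrow> real"
  assumes "(\<lambda>e. (a e)\<^sup>2) summable_on A" "(\<lambda>e. (b e)\<^sup>2) summable_on A"
  shows "(\<lambda>e. (a e + t * b e)\<^sup>2) summable_on A"
proof (rule summable_on_comparison_test)
  show "(\<lambda>e. 2 * (a e)\<^sup>2 + 2 * t\<^sup>2 * (b e)\<^sup>2) summable_on A"
    by (intro summable_on_add summable_on_cmult_right assms)
  fix e
  have "0 \<le> (a e - t * b e)\<^sup>2" by simp
  then show "(a e + t * b e)\<^sup>2 \<le> 2 * (a e)\<^sup>2 + 2 * t\<^sup>2 * (b e)\<^sup>2"
    by (simp add: power2_eq_square algebra_simps)
qed auto

locale network =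
  fixes V :: "'a set" and E :: "'a set set" and tail head :: "'a set \<Rightarrow> 'a"
  assumes simple: "simple_graph V E"
    and orient: "orientation E tail head"
    and locfin: "locally_finite_graph V E"
begin

definition grad :: "('a \<Rightarrow> real) \<Rightarrow> 'a set \<Rightarrow> real" where
  "grad u e = u (tail e) - u (head e)"

lemma edge:
  assumes "e \<in> E"
  shows "e = {tail e, head e}" "tail e \<noteq> head e" "tail e \<in> V" "head e \<in> V"
proof -
  show 1: "e = {tail e, head e}" using orient assms by (simp add: orientation_def)
  have 2: "e \<subseteq> V" "card e = 2" using simple assms by (auto simp: simple_graph_def)
  have "card {tail e, head e} = 2" using 1 2(2) by simp
  then show "tail e \<noteq> head e" by auto
  show "tail e \<in> V" "head e \<in> V" using 1 2(1) by blast+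
qed

lemma edge_ends:
  assumes "e \<in> E"
  shows "v \<in> e \<longleftrightarrow> v = tail e \<or> v = head e"
  by (subst edge(1)[OF assms]) simp

lemma edge_pair: "{a, b} \<in> E \<Longrightarrow> a \<in> V \<and> b \<in> V \<and> a \<noteq> b"
  using edge[of "{a, b}"] by (metis doubleton_eq_iff)

lemma edge_cases:
  assumes "{a, b} \<in> E"
  shows "tail {a, b} = a \<and> head {a, b} = b \<or> tail {a, b} = b \<and> head {a, b} = a"
  using edge(1)[OF assms] by (metis doubleton_eq_iff)

lemma grad_pair: "{a, b} \<in> E \<Longrightarrow> \<bar>grad u {a, b}\<bar> = \<bar>u a - u b\<bar>"
  using edge_cases unfolding grad_def by fastforce

lemma finite_incident: "finite (incident_edges E v)"
proof (cases "v \<in> V")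
  case True
  then show ?thesis using locfin by (simp add: locally_finite_graph_def)
next
  case False
  then have "incident_edges E v = {}" using simple by (auto simp: incident_edges_def simple_graph_def)
  then show ?thesis by simp
qed

lemma finite_touching:
  assumes "finite W"
  shows "finite {e \<in> E. e \<inter> W \<noteq> {}}"
proof -
  have "{e \<in> E. e \<inter> W \<noteq> {}} = (\<Union>v\<in>W. incident_edges E v)" by (auto simp: incident_edges_def)
  then show ?thesis using assms finite_incident by simp
qed

lemma incident_edges_eq: "incident_edges E z = (\<lambda>y. {z, y}) ` neighbours E z"
proof
  show "incident_edges E z \<subseteq> (\<lambda>y. {z, y}) ` neighbours E z"
  proof
    fix e assume "e \<in> incident_edges E z"
    then have e: "e \<in> E" "z \<in> e" by (auto simp: incident_edges_def)
    obtain y where "e = {z, y}"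
    proof (cases "z = tail e")
      case True
      then show thesis using that[of "head e"] edge(1)[OF e(1)] by simp
    next
      case False
      then have "z = head e" using e(2) edge(1)[OF e(1)] by (metis insertE singletonD)
      then show thesis using that[of "tail e"] edge(1)[OF e(1)] by (simp add: insert_commute)
    qed
    then show "e \<in> (\<lambda>y. {z, y}) ` neighbours E z" using e by (auto simp: neighbours_def)
  qed
qed (auto simp: incident_edges_def neighbours_def)

lemma inj_neighbours: "inj_on (\<lambda>y. {z, y}) (neighbours E z)"
  by (auto simp: inj_on_def doubleton_eq_iff)

lemma sum_incident: "(\<Sum>e\<in>incident_edges E z. g e) = (\<Sum>y\<in>neighbours E z. g {z, y})"
  unfolding incident_edges_eq by (simp add: sum.reindex[OF inj_neighbours])

lemma finite_neighbours: "finite (neighbours E z)"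
  using finite_incident[of z] unfolding incident_edges_eq by (rule finite_imageD) (rule inj_neighbours)

lemma degree_eq: "vertex_degree E z = card (neighbours E z)"
  unfolding vertex_degree_def incident_edges_eq by (rule card_image[OF inj_neighbours])

lemma harmonic_atI:
  assumes "neighbours E z \<noteq> {}" "(\<Sum>y\<in>neighbours E z. h z - h y) = 0"
  shows "h z = 1 / real (vertex_degree E z) * (\<Sum>y\<in>neighbours E z. h y)"
proof -
  have "card (neighbours E z) \<noteq> 0" using assms(1) finite_neighbours by simp
  then show ?thesis using assms(2) unfolding degree_eq by (simp add: sum_subtractf field_simps)
qed

lemma finite_energy_iff: "finite_energy E tail head u \<longleftrightarrow> (\<lambda>e. (grad u e)\<^sup>2) summable_on E"
  by (simp add: finite_energy_def grad_def)

lemma grad_lin: "grad (\<lambda>v. a v + t * b v) e = grad a e + t * grad b e"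
  by (simp add: grad_def algebra_simps)

lemma finite_energy_lin:
  "finite_energy E tail head a \<Longrightarrow> finite_energy E tail head b \<Longrightarrow> finite_energy E tail head (\<lambda>v. a v + t * b v)"
  unfolding finite_energy_iff grad_lin by (rule sum_square_summable)

lemma finite_energy_finite_support:
  assumes "finite {e \<in> E. grad u e \<noteq> 0}"
  shows "finite_energy E tail head u"
proof -
  have "(\<lambda>e. (grad u e)\<^sup>2) summable_on {e \<in> E. grad u e \<noteq> 0}" using assms by simp
  then show ?thesis unfolding finite_energy_iff
    by (rule summable_on_cong_neutral[THEN iffD1, rotated -1]) auto
qed

lemma grad_finite_support:
  assumes "finite {v. u v \<noteq> 0}"
  shows "finite {e \<in> E. grad u e \<noteq> 0}"
proof (rule finite_subset[OF _ finite_touching[OF assms]])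
  show "{e \<in> E. grad u e \<noteq> 0} \<subseteq> {e \<in> E. e \<inter> {v. u v \<noteq> 0} \<noteq> {}}"
  proof
    fix e assume e: "e \<in> {e \<in> E. grad u e \<noteq> 0}"
    then have "u (tail e) \<noteq> 0 \<or> u (head e) \<noteq> 0" by (auto simp: grad_def)
    then show "e \<in> {e \<in> E. e \<inter> {v. u v \<noteq> 0} \<noteq> {}}" using e edge_ends[of e] by blast
  qed
qed

definition energy :: "('a \<Rightarrow> real) \<Rightarrow> real" where
  "energy u = (\<Sum>\<^sub>\<infinity>e\<in>E. (grad u e)\<^sup>2)"

lemma energy_nonneg: "0 \<le> energy u"
  unfolding energy_def by (rule infsum_nonneg) auto

lemma sum_le_energy:
  assumes "finite_energy E tail head u" "finite A" "A \<subseteq> E"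
  shows "(\<Sum>e\<in>A. (grad u e)\<^sup>2) \<le> energy u"
  unfolding energy_def using assms by (intro finite_sum_le_infsum) (auto simp: finite_energy_iff)

text \<open>
  The parallelogram law makes a minimising sequence a Cauchy sequence in energy.
\<close>

lemma energy_parallelogram:
  assumes "finite_energy E tail head a" "finite_energy E tail head b"
  shows "energy (\<lambda>v. a v - b v) + 4 * energy (\<lambda>v. (a v + b v) / 2) = 2 * energy a + 2 * energy b"
proof -
  have s: "(\<lambda>e. (grad a e)\<^sup>2) summable_on E" "(\<lambda>e. (grad b e)\<^sup>2) summable_on E"
    using assms by (auto simp: finite_energy_iff)
  have d: "(\<lambda>e. (grad (\<lambda>v. a v - b v) e)\<^sup>2) summable_on E"
    using finite_energy_lin[OF assms, of "- 1"] by (simp add: finite_energy_iff)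
  have m: "(\<lambda>e. (grad (\<lambda>v. (a v + b v) / 2) e)\<^sup>2) summable_on E"
  proof -
    have "(\<lambda>e. (1/4) * (grad (\<lambda>v. a v + 1 * b v) e)\<^sup>2) summable_on E"
      using finite_energy_lin[OF assms, of 1] by (intro summable_on_cmult_right) (simp add: finite_energy_iff)
    then show ?thesis
      by (rule summable_on_cong[THEN iffD1, rotated]) (simp add: grad_def power2_eq_square field_simps)
  qed
  have "energy (\<lambda>v. a v - b v) + 4 * energy (\<lambda>v. (a v + b v) / 2) =
      (\<Sum>\<^sub>\<infinity>e\<in>E. (grad (\<lambda>v. a v - b v) e)\<^sup>2 + 4 * (grad (\<lambda>v. (a v + b v) / 2) e)\<^sup>2)"
    unfolding energy_def using d m
    by (simp add: infsum_add summable_on_cmult_right infsum_cmult_right)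
  also have "\<dots> = (\<Sum>\<^sub>\<infinity>e\<in>E. 2 * (grad a e)\<^sup>2 + 2 * (grad b e)\<^sup>2)"
    by (rule infsum_cong) (simp add: grad_def power2_eq_square field_simps)
  also have "\<dots> = 2 * energy a + 2 * energy b"
    unfolding energy_def using s by (simp add: infsum_add summable_on_cmult_right infsum_cmult_right)
  finally show ?thesis .
qed

text \<open>
  The first-order term in \<open>t\<close> is the defect of harmonicity at \<open>z\<close>, so it vanishes for a minimiser.
\<close>

lemma energy_variation:
  assumes "finite_energy E tail head a"
  shows "energy (\<lambda>v. a v + t * indicator {z} v) =
    energy a + (2 * t * (\<Sum>y\<in>neighbours E z. a z - a y) + t\<^sup>2 * vertex_degree E z)"
proof -
  define r where "r = (\<lambda>e. 2 * t * (grad a e * grad (indicator {z}) e) + t\<^sup>2 * (grad (indicator {z}) e)\<^sup>2)"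
  have r0: "r e = 0" if "e \<in> E - incident_edges E z" for e
    using that edge_ends[of e z] by (auto simp: r_def grad_def incident_edges_def indicator_def)
  have sub: "incident_edges E z \<subseteq> E" by (auto simp: incident_edges_def)
  have rsum: "r summable_on E"
  proof -
    have "r summable_on incident_edges E z" using finite_incident by simp
    then show ?thesis by (rule summable_on_cong_neutral[THEN iffD1, rotated -1]) (use r0 sub in auto)
  qed
  have val: "r {z, y} = 2 * t * (a z - a y) + t\<^sup>2" if "y \<in> neighbours E z" for y
  proof -
    have "{z, y} \<in> E" using that by (simp add: neighbours_def)
    then show ?thesis using edge_cases[of z y] edge_pair[of z y]
      by (auto simp: r_def grad_def indicator_def algebra_simps)
  qed
  have "energy (\<lambda>v. a v + t * indicator {z} v) = (\<Sum>\<^sub>\<infinity>e\<in>E. (grad a e)\<^sup>2 + r e)"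
    unfolding energy_def grad_lin
    by (rule infsum_cong) (simp add: r_def power2_eq_square algebra_simps)
  also have "\<dots> = energy a + infsum r E"
    unfolding energy_def using assms rsum by (intro infsum_add) (auto simp: finite_energy_iff)
  also have "infsum r E = infsum r (incident_edges E z)"
    by (rule infsum_cong_neutral) (use r0 sub in auto)
  also have "\<dots> = (\<Sum>y\<in>neighbours E z. r {z, y})" using finite_incident by (simp add: sum_incident)
  also have "\<dots> = (\<Sum>y\<in>neighbours E z. 2 * t * (a z - a y) + t\<^sup>2)" by (rule sum.cong) (auto simp: val)
  also have "\<dots> = 2 * t * (\<Sum>y\<in>neighbours E z. a z - a y) + t\<^sup>2 * vertex_degree E z"
    by (simp add: sum.distrib sum_distrib_left degree_eq)
  finally show ?thesis .
qed


text \<open>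
  Double counting of pairs of an edge of \<open>A\<close> and an end of it.
\<close>

lemma degree_weighted_sum:
  fixes k :: "'a \<Rightarrow> real"
  assumes A: "finite A" "A \<subseteq> E" and k: "\<And>v. 0 \<le> k v"
  shows "(\<Sum>e\<in>A. k (tail e) + k (head e)) \<le> (\<Sum>v\<in>\<Union>A. vertex_degree E v * k v)"
proof -
  have fin: "finite (\<Union>A)"
    using A edge(1) by (metis finite.simps finite_Union subsetD)
  have ends: "{v \<in> \<Union>A. v \<in> e} = {tail e, head e}" if "e \<in> A" for e
    using that A(2) edge_ends[of e] by blast
  have "(\<Sum>e\<in>A. k (tail e) + k (head e)) = (\<Sum>e\<in>A. \<Sum>v\<in>{v \<in> \<Union>A. v \<in> e}. k v)"
    using ends edge(2) A(2) by (intro sum.cong) auto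
  also have "\<dots> = (\<Sum>v\<in>\<Union>A. \<Sum>e\<in>{e \<in> A. v \<in> e}. k v)"
    by (rule sum.swap_restrict) (use A fin in auto)
  also have "\<dots> \<le> (\<Sum>v\<in>\<Union>A. vertex_degree E v * k v)"
  proof (rule sum_mono)
    fix v
    have "card {e \<in> A. v \<in> e} \<le> vertex_degree E v"
      unfolding vertex_degree_def using A(2) by (intro card_mono finite_incident) (auto simp: incident_edges_def)
    then show "(\<Sum>e\<in>{e \<in> A. v \<in> e}. k v) \<le> vertex_degree E v * k v"
      using k[of v] by (simp add: mult_right_mono)
  qed
  finally show ?thesis .
qed

lemma sum_incident_le:
  fixes k :: "'a \<Rightarrow> real" and g :: "'a set \<Rightarrow> real"
  assumes W: "finite W" and k: "\<And>v. 0 \<le> k v" and g: "\<And>e. 0 \<le> g e"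
  shows "(\<Sum>v\<in>W. k v * (\<Sum>e\<in>incident_edges E v. g e))
    \<le> (\<Sum>e\<in>{e \<in> E. e \<inter> W \<noteq> {}}. (k (tail e) + k (head e)) * g e)"
proof -
  define A where "A = {e \<in> E. e \<inter> W \<noteq> {}}"
  have A: "finite A" unfolding A_def using finite_touching[OF W] .
  have inc: "{e \<in> A. v \<in> e} = incident_edges E v" if "v \<in> W" for v
    using that unfolding A_def incident_edges_def by auto
  have "(\<Sum>v\<in>W. k v * (\<Sum>e\<in>incident_edges E v. g e)) = (\<Sum>v\<in>W. \<Sum>e\<in>{e \<in> A. v \<in> e}. k v * g e)"
    by (intro sum.cong) (auto simp: inc sum_distrib_left)
  also have "\<dots> = (\<Sum>e\<in>A. \<Sum>v\<in>{v \<in> W. v \<in> e}. k v * g e)"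
    by (rule sum.swap_restrict) (use A W in auto)
  also have "\<dots> \<le> (\<Sum>e\<in>A. (k (tail e) + k (head e)) * g e)"
  proof (rule sum_mono)
    fix e assume "e \<in> A"
    then have e: "e \<in> E" unfolding A_def by simp
    have "(\<Sum>v\<in>{v \<in> W. v \<in> e}. k v * g e) \<le> (\<Sum>v\<in>{tail e, head e}. k v * g e)"
      using edge_ends[OF e] k g by (intro sum_mono2) auto
    also have "\<dots> = (k (tail e) + k (head e)) * g e" using edge(2)[OF e] by (simp add: algebra_simps)
    finally show "(\<Sum>v\<in>{v \<in> W. v \<in> e}. k v * g e) \<le> (k (tail e) + k (head e)) * g e" .
  qed
  finally show ?thesis unfolding A_def .
qed

section \<open>Graphs without non-constant Dirichlet harmonic functions\<close>

text \<open>
  Take a minimising sequence for the energy of \<open>u - \<phi>\<close> over finitely supported \<open>\<phi>\<close>. By the parallelogram law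
  its gradients converge on every edge, so after normalisation at \<open>x\<close> the functions converge at every vertex of the
  connected graph. The limit \<open>h\<close> has finite energy and is harmonic, because perturbing \<open>\<phi>\<close> at one vertex cannot
  lower the infimum. So \<open>h\<close> is constant, and the Cauchy estimate against this limit bounds the
  energies of the sequence itself.
\<close>

lemma finitely_supported_approximation:
  assumes x: "x \<in> V" and conn: "\<And>z. z \<in> V \<Longrightarrow> joined E V x z"
    and deg: "\<And>z. z \<in> V \<Longrightarrow> neighbours E z \<noteq> {}"
    and trivial: "\<And>h. dirichlet_harmonic V E tail head h \<Longrightarrow> h constant_on V"
    and u: "finite_energy E tail head u" and eps: "0 < \<epsilon>"
  obtains \<phi> where "finite {v. \<phi> v \<noteq> 0}" "finite_energy E tail head (\<lambda>v. u v - \<phi> v)"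
     "energy (\<lambda>v. u v - \<phi> v) \<le> \<epsilon>"
proof -
  define \<Phi> where "\<Phi> = {\<phi> :: 'a \<Rightarrow> real. finite {v. \<phi> v \<noteq> 0}}"
  define F where "F = (\<lambda>\<phi>. energy (\<lambda>v. u v - \<phi> v))"
  have fe: "finite_energy E tail head (\<lambda>v. u v - \<phi> v)" if "\<phi> \<in> \<Phi>" for \<phi>
    using finite_energy_lin[OF u finite_energy_finite_support[OF grad_finite_support], of \<phi> "- 1"] that
    unfolding \<Phi>_def by simp
  have bdd: "bdd_below (F ` \<Phi>)" unfolding F_def using energy_nonneg by (intro bdd_belowI[of _ 0]) auto
  have ne: "F ` \<Phi> \<noteq> {}" unfolding \<Phi>_def by (auto intro!: exI[of _ "\<lambda>_. 0"])
  define I where "I = Inf (F ` \<Phi>)"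
  have I_le: "I \<le> F \<phi>" if "\<phi> \<in> \<Phi>" for \<phi> unfolding I_def using that bdd by (auto intro: cInf_lower)
  have "\<exists>\<phi>. \<phi> \<in> \<Phi> \<and> F \<phi> < I + 1 / real (Suc n)" for n
    using cInf_less_iff[OF ne bdd, of "I + 1 / real (Suc n)"] unfolding I_def by auto
  then obtain ph where ph: "\<And>n. ph n \<in> \<Phi>" "\<And>n. F (ph n) < I + 1 / real (Suc n)" by metis
  define g where "g = (\<lambda>n v. u v - ph n v)"
  have gfe: "finite_energy E tail head (g n)" for n unfolding g_def using fe ph by simp
  have gen: "energy (g n) < I + 1 / real (Suc n)" for n using ph(2)[of n] by (simp add: g_def F_def)
  define \<delta> where "\<delta> = (\<lambda>n m. 2 / real (Suc n) + 2 / real (Suc m))"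
  have cauchy: "(grad (g n) e - grad (g m) e)\<^sup>2 \<le> \<delta> n m" and
    cauchy_sum: "finite A \<Longrightarrow> A \<subseteq> E \<Longrightarrow> (\<Sum>e\<in>A. (grad (g n) e - grad (g m) e)\<^sup>2) \<le> \<delta> n m"
    if "e \<in> E" for n m e A
  proof -
    have half: "(\<lambda>v. (ph n v + ph m v) / 2) \<in> \<Phi>"
    proof -
      have "{v. (ph n v + ph m v) / 2 \<noteq> 0} \<subseteq> {v. ph n v \<noteq> 0} \<union> {v. ph m v \<noteq> 0}" by auto
      then show ?thesis using ph(1)[of n] ph(1)[of m] unfolding \<Phi>_def by (auto intro: finite_subset)
    qed
    have "(\<lambda>v. (g n v + g m v) / 2) = (\<lambda>v. u v - (ph n v + ph m v) / 2)"
      by (auto simp: g_def field_simps)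
    then have "I \<le> energy (\<lambda>v. (g n v + g m v) / 2)" using I_le[OF half] unfolding F_def by simp
    then have le: "energy (\<lambda>v. g n v - g m v) \<le> \<delta> n m"
      using energy_parallelogram[OF gfe[of n] gfe[of m]] gen[of n] gen[of m] unfolding \<delta>_def by simp
    have fed: "finite_energy E tail head (\<lambda>v. g n v - g m v)"
      using finite_energy_lin[OF gfe[of n] gfe[of m], of "- 1"] by simp
    have gd: "grad (\<lambda>v. g n v - g m v) e = grad (g n) e - grad (g m) e" for e by (simp add: grad_def)
    show sum: "(\<Sum>e\<in>A. (grad (g n) e - grad (g m) e)\<^sup>2) \<le> \<delta> n m" if "finite A" "A \<subseteq> E" for A
      using sum_le_energy[OF fed that] le by (simp add: gd)
    show "(grad (g n) e - grad (g m) e)\<^sup>2 \<le> \<delta> n m" using sum[of "{e}"] \<open>e \<in> E\<close> by simp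
  qed
  have conv: "convergent (\<lambda>n. grad (g n) e)" if e: "e \<in> E" for e
  proof -
    have "Cauchy (\<lambda>n. grad (g n) e)"
    proof (rule CauchyI')
      fix r :: real assume r: "0 < r"
      obtain M where M: "4 / real (Suc M) < r\<^sup>2"
      proof -
        obtain M where "4 / r\<^sup>2 < real M" using reals_Archimedean2 by blast
        then have "4 / real (Suc M) < r\<^sup>2" using r by (simp add: field_simps) (smt (verit) zero_less_power)
        then show thesis by (rule that)
      qed
      have "dist (grad (g m) e) (grad (g n) e) < r" if "M \<le> m" "m < n" for m n
      proof -
        have "2 / real (Suc m) \<le> 2 / real (Suc M)" "2 / real (Suc n) \<le> 2 / real (Suc M)"
          using that by (auto intro!: divide_left_mono)
        then have "(grad (g m) e - grad (g n) e)\<^sup>2 < r\<^sup>2" using cauchy[OF e, of m n] M unfolding \<delta>_def by linarith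
        then show ?thesis using r power2_less_imp_less[of "\<bar>grad (g m) e - grad (g n) e\<bar>" r] by (simp add: dist_real_def)
      qed
      then show "\<exists>M. \<forall>m\<ge>M. \<forall>n>m. dist (grad (g m) e) (grad (g n) e) < r" by blast
    qed
    then show ?thesis by (simp add: Cauchy_convergent_iff)
  qed
  have convv: "convergent (\<lambda>n. g n z - g n x)" if "z \<in> V" for z
    using conn[OF that]
  proof (induction rule: joined_induct)
    case refl
    then show ?case by (simp add: convergent_const)
  next
    case (step b c)
    have "convergent (\<lambda>n. g n b - g n c)"
      using edge_cases[OF step(4)] conv[OF step(4)] convergent_minus_iff[of "\<lambda>n. grad (g n) {b, c}"]
      by (auto simp: grad_def)
    from convergent_diff[OF step(5) this] show ?case by simp
  qed
  define h where "h = (\<lambda>z. lim (\<lambda>n. g n z - g n x))"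
  have h: "(\<lambda>n. g n z - g n x) \<longlonglongrightarrow> h z" if "z \<in> V" for z
    using convv[OF that] unfolding h_def by (simp add: convergent_LIMSEQ_iff)
  have hdiff: "(\<lambda>n. g n a - g n b) \<longlonglongrightarrow> h a - h b" if "a \<in> V" "b \<in> V" for a b
    using tendsto_diff[OF h[OF that(1)] h[OF that(2)]] by simp
  have hgrad: "(\<lambda>n. grad (g n) e) \<longlonglongrightarrow> grad h e" if "e \<in> E" for e
    unfolding grad_def using hdiff edge[OF that] by simp
  have hfe: "finite_energy E tail head h"
    unfolding finite_energy_iff
  proof (rule nonneg_bdd_above_summable_on)
    show "bdd_above (sum (\<lambda>e. (grad h e)\<^sup>2) ` {F. F \<subseteq> E \<and> finite F})"
    proof (rule bdd_aboveI2)
      fix A assume A: "A \<in> {F. F \<subseteq> E \<and> finite F}"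
      have "(\<lambda>n. \<Sum>e\<in>A. (grad (g n) e)\<^sup>2) \<longlonglongrightarrow> (\<Sum>e\<in>A. (grad h e)\<^sup>2)"
        using A hgrad by (intro tendsto_sum tendsto_power) auto
      moreover have "(\<Sum>e\<in>A. (grad (g n) e)\<^sup>2) \<le> I + 1" for n
      proof -
        have "(\<Sum>e\<in>A. (grad (g n) e)\<^sup>2) \<le> energy (g n)" using A gfe by (intro sum_le_energy) auto
        moreover have "1 / real (Suc n) \<le> 1" by simp
        ultimately show ?thesis using gen[of n] by linarith
      qed
      ultimately show "(\<Sum>e\<in>A. (grad h e)\<^sup>2) \<le> I + 1" using LIMSEQ_le_const2 by blast
    qed
  qed auto
  have "harmonic V E h"
    unfolding harmonic_def
  proof (intro ballI harmonic_atI)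
    fix z assume z: "z \<in> V"
    show "neighbours E z \<noteq> {}" using deg z .
    define B where "B = (\<Sum>y\<in>neighbours E z. h z - h y)"
    define d where "d = real (vertex_degree E z)"
    have d: "d > 0" unfolding d_def degree_eq using deg[OF z] finite_neighbours by (simp add: card_gt_0_iff)
    have lim: "(\<lambda>n. \<Sum>y\<in>neighbours E z. g n z - g n y) \<longlonglongrightarrow> B"
      unfolding B_def using z edge_pair by (intro tendsto_sum hdiff) (auto simp: neighbours_def)
    have var: "0 \<le> 2 * t * B + t\<^sup>2 * d" for t
    proof -
      have "0 \<le> 1 / real (Suc n) + (2 * t * (\<Sum>y\<in>neighbours E z. g n z - g n y) + t\<^sup>2 * d)" for n
      proof -
        have mem: "(\<lambda>v. ph n v - t * indicator {z} v) \<in> \<Phi>"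
        proof -
          have "{v. ph n v - t * indicator {z} v \<noteq> 0} \<subseteq> {v. ph n v \<noteq> 0} \<union> {z}"
            by (auto simp: indicator_def)
          then show ?thesis using ph(1)[of n] unfolding \<Phi>_def by (auto intro: finite_subset)
        qed
        have "F (\<lambda>v. ph n v - t * indicator {z} v) = energy (\<lambda>v. g n v + t * indicator {z} v)"
          unfolding F_def g_def by (simp add: algebra_simps)
        then have "I \<le> energy (\<lambda>v. g n v + t * indicator {z} v)" using I_le[OF mem] by simp
        then show ?thesis using gen[of n] unfolding energy_variation[OF gfe] d_def by linarith
      qed
      moreover have "(\<lambda>n. 1 / real (Suc n) + (2 * t * (\<Sum>y\<in>neighbours E z. g n z - g n y) + t\<^sup>2 * d))
          \<longlonglongrightarrow> 0 + (2 * t * B + t\<^sup>2 * d)"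
        using LIMSEQ_inverse_real_of_nat by (intro tendsto_intros lim) (simp add: inverse_eq_divide)
      ultimately show ?thesis using LIMSEQ_le_const[of _ "2 * t * B + t\<^sup>2 * d" 0] by auto
    qed
    \<comment> \<open>The minimum of the quadratic function of \<open>t\<close> is attained at \<open>- B / d\<close>.\<close>
    have "0 \<le> 2 * (- B / d) * B + (- B / d)\<^sup>2 * d" by (rule var)
    also have "\<dots> = - (B\<^sup>2 / d)" using d by (simp add: field_simps power2_eq_square)
    finally have "B\<^sup>2 \<le> 0" using d by (simp add: divide_le_0_iff)
    then show "(\<Sum>y\<in>neighbours E z. h z - h y) = 0" unfolding B_def by simp
  qed
  then have "h constant_on V" using trivial hfe by (simp add: dirichlet_harmonic_def)
  then have h0: "grad h e = 0" if "e \<in> E" for e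
    using edge[OF that] unfolding constant_on_def grad_def by auto
  obtain n where n: "2 / real (Suc n) \<le> \<epsilon>"
  proof -
    obtain M where "2 / \<epsilon> < real M" using reals_Archimedean2 by blast
    then have "2 / real (Suc M) \<le> \<epsilon>" using eps by (simp add: field_simps)
    then show thesis by (rule that)
  qed
  have "energy (g n) \<le> 2 / real (Suc n)"
    unfolding energy_def
  proof (rule infsum_le_finite_sums)
    show "(\<lambda>e. (grad (g n) e)\<^sup>2) summable_on E" using gfe by (simp add: finite_energy_iff)
    fix A assume A: "finite A" "A \<subseteq> E"
    have "(\<lambda>m. \<Sum>e\<in>A. (grad (g n) e - grad (g m) e)\<^sup>2) \<longlonglongrightarrow> (\<Sum>e\<in>A. (grad (g n) e - 0)\<^sup>2)"
      using A hgrad h0 by (intro tendsto_intros) (metis subsetD)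
    moreover have "(\<lambda>m. \<delta> n m) \<longlonglongrightarrow> 2 / real (Suc n) + 2 * 0"
    proof -
      have "(\<lambda>m. 2 / real (Suc n) + 2 * inverse (real (Suc m))) \<longlonglongrightarrow> 2 / real (Suc n) + 2 * 0"
        by (intro tendsto_intros LIMSEQ_inverse_real_of_nat)
      then show ?thesis by (simp add: \<delta>_def divide_inverse)
    qed
    moreover have "(\<Sum>e\<in>A. (grad (g n) e - grad (g m) e)\<^sup>2) \<le> \<delta> n m" for m
    proof (cases "A = {}")
      case True
      then show ?thesis by (simp add: \<delta>_def)
    next
      case False
      then show ?thesis using cauchy_sum A by blast
    qed
    ultimately show "(\<Sum>e\<in>A. (grad (g n) e)\<^sup>2) \<le> 2 / real (Suc n)"
      using LIMSEQ_le[of _ "\<Sum>e\<in>A. (grad (g n) e - 0)\<^sup>2" "\<lambda>m. \<delta> n m" "2 / real (Suc n) + 2 * 0"] by auto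
  qed
  then show thesis using that[of "ph n"] ph(1)[of n] fe[OF ph(1)[of n]] n
    unfolding \<Phi>_def g_def by auto
qed

section \<open>Three arms between connected sets\<close>

text \<open>
  Each arm \<open>T i\<close> is cut at the vertex \<open>p i\<close> that the connection \<open>R i\<close>, followed from \<open>q\<close>, hits first. The three
  vertices \<open>p i\<close> form one side of a \<open>K\<^sub>3\<^sub>,\<^sub>3\<close> minor. The other side is formed by \<open>X\<close> with the pieces of the arms before the
  cuts, \<open>K\<close> with the pieces after the cuts, and the parts of the connections before they hit their arms, which
  all contain \<open>q\<close>.
\<close>

lemma no_three_arms:
  fixes T :: "nat \<Rightarrow> 'a list"
  assumes emb: "plane_embedding V E pos \<gamma>"
    and X: "X \<subseteq> V" "connected_in E X" and K: "K \<subseteq> V" "connected_in E K" and XK: "X \<inter> K = {}"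
    and T: "\<And>i. i < 3 \<Longrightarrow> T i \<noteq> []" "\<And>i. i < 3 \<Longrightarrow> distinct (T i)"
      "\<And>i. i < 3 \<Longrightarrow> successively (\<lambda>a b. {a, b} \<in> E) (T i)" "\<And>i. i < 3 \<Longrightarrow> set (T i) \<subseteq> V - X - K"
      "\<And>i. i < 3 \<Longrightarrow> \<exists>a\<in>X. {a, hd (T i)} \<in> E" "\<And>i. i < 3 \<Longrightarrow> \<exists>k\<in>K. {k, last (T i)} \<in> E"
      "\<And>i j. i < 3 \<Longrightarrow> j < 3 \<Longrightarrow> i \<noteq> j \<Longrightarrow> set (T i) \<inter> set (T j) = {}"
    and R: "\<And>i. i < 3 \<Longrightarrow> R i \<subseteq> V - X - K" "\<And>i. i < 3 \<Longrightarrow> joined E (R i) (hd (T i)) q"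
      "\<And>i j. i < 3 \<Longrightarrow> j < 3 \<Longrightarrow> i \<noteq> j \<Longrightarrow> R i \<inter> set (T j) = {}"
  shows False
proof -
  have qR: "q \<in> R i" if "i < 3" for i using joined_right[OF R(2)[OF that]] .
  have qT: "q \<notin> set (T i)" if i: "i < 3" for i
  proof -
    obtain j :: nat where "j < 3" "j \<noteq> i" by (metis less_numeral_extra(3) one_less_numeral_iff semiring_norm(77) zero_less_numeral zero_neq_one)
    then show ?thesis using qR[of j] R(3)[of j i] i by blast
  qed
  have "\<exists>ys p zs c. T i = ys @ p # zs \<and> p \<in> R i \<and> joined E (R i - set (T i)) q c \<and> {c, p} \<in> E" if i: "i < 3" for i
  proof -
    have "joined E (R i) q (hd (T i))" using R(2)[OF i] by (rule joined_sym)
    from joined_hitting[OF this qT[OF i] hd_in_set[OF T(1)[OF i]]]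
    obtain p c where p: "p \<in> set (T i)" "p \<in> R i" "joined E (R i - set (T i)) q c" "{c, p} \<in> E" by blast
    then show ?thesis using split_list[OF p(1)] by blast
  qed
  then obtain ys p zs c where split: "\<And>i. i < 3 \<Longrightarrow> T i = ys i @ p i # zs i"
    and pR: "\<And>i. i < 3 \<Longrightarrow> p i \<in> R i" and c: "\<And>i. i < 3 \<Longrightarrow> joined E (R i - set (T i)) q (c i)"
    and cp: "\<And>i. i < 3 \<Longrightarrow> {c i, p i} \<in> E"
    by metis
  define A where "A = X \<union> (\<Union>i<3. set (ys i))"
  define B where "B = K \<union> (\<Union>i<3. set (zs i))"
  define C where "C = (\<Union>i<3. {c. joined E (R i - set (T i)) q c})"
  have succ: "successively (\<lambda>a b. {a, b} \<in> E) (ys i)" "successively (\<lambda>a b. {a, b} \<in> E) (zs i)"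
      "ys i \<noteq> [] \<Longrightarrow> {last (ys i), p i} \<in> E" "zs i \<noteq> [] \<Longrightarrow> {p i, hd (zs i)} \<in> E" if "i < 3" for i
    using T(3)[OF that] unfolding split[OF that] by (auto simp: successively_append_iff successively_Cons)
  have Tset: "set (T i) = set (ys i) \<union> {p i} \<union> set (zs i)"
     "set (ys i) \<inter> set (zs i) = {}" "p i \<notin> set (ys i)" "p i \<notin> set (zs i)" if "i < 3" for i
    using T(2)[OF that] unfolding split[OF that] by auto
  have CR: "C \<subseteq> (\<Union>i<3. R i - set (T i))" unfolding C_def using joined_right by fast
  have pT: "p i \<in> set (T i)" if "i < 3" for i using Tset(1)[OF that] by blast
  have XT: "set (T i) \<inter> X = {}" "set (T i) \<inter> K = {}" "set (T i) \<subseteq> V" "R i \<inter> X = {}" "R i \<inter> K = {}" "R i \<subseteq> V" if "i < 3" for i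
    using T(4)[OF that] R(1)[OF that] by blast+
  have CT: "C \<inter> set (T i) = {}" if i: "i < 3" for i
  proof -
    have "(R j - set (T j)) \<inter> set (T i) = {}" if "j < 3" for j
      using R(3)[OF that i] by (cases "j = i") auto
    then show ?thesis using CR by blast
  qed
  have ysT: "set (ys i) \<subseteq> set (T i)" "set (zs i) \<subseteq> set (T i)" if "i < 3" for i using Tset(1)[OF that] by blast+
  have dis: "set (ys i) \<inter> set (zs j) = {}" if "i < 3" "j < 3" for i j
  proof (cases "i = j")
    case True
    then show ?thesis using Tset(2) that by simp
  next
    case False
    then show ?thesis using T(7)[OF that False] ysT that by blast
  qed
  have pout: "p i \<notin> set (ys j)" "p i \<notin> set (zs j)" if "i < 3" "j < 3" for i j
  proof -
    have "p i \<notin> set (ys j) \<and> p i \<notin> set (zs j)"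
    proof (cases "i = j")
      case True
      then show ?thesis using Tset(3,4) that by simp
    next
      case False
      then show ?thesis using T(7)[OF that False] ysT pT that by blast
    qed
    then show "p i \<notin> set (ys j)" "p i \<notin> set (zs j)" by auto
  qed
  have pne: "p i \<noteq> p j" if "i < 3" "j < 3" "i \<noteq> j" for i j
    using T(7)[OF that] pT that by (metis disjoint_iff)
  obtain a0 where a0: "a0 \<in> X" using T(5)[of 0] by auto
  obtain k0 where k0: "k0 \<in> K" using T(6)[of 0] by auto
  have A: "connected_in E A"
  proof (rule connected_inI[of _ _ a0])
    fix b assume b: "b \<in> A"
    have base: "joined E A a0 a" if "a \<in> X" for a
      using X(2) a0 that joined_mono[of E X a0 a A] unfolding connected_in_def A_def by blast
    show "joined E A a0 b"
    proof (cases "b \<in> X")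
      case False
      then obtain i where i: "i < 3" "b \<in> set (ys i)" using b unfolding A_def by auto
      obtain a where a: "a \<in> X" "{a, hd (T i)} \<in> E" using T(5)[OF i(1)] by blast
      show ?thesis
      proof (rule joined_along[OF succ(1)[OF i(1)] _ base[OF a(1)] _ i(2)])
        show "set (ys i) \<subseteq> A" unfolding A_def using i(1) by blast
        show "ys i \<noteq> [] \<Longrightarrow> {a, hd (ys i)} \<in> E" using a(2) unfolding split[OF i(1)] by simp
      qed
    qed (rule base)
  qed
  have B: "connected_in E B"
  proof (rule connected_inI[of _ _ k0])
    fix b assume b: "b \<in> B"
    have base: "joined E B k0 a" if "a \<in> K" for a
      using K(2) k0 that joined_mono[of E K k0 a B] unfolding connected_in_def B_def by blast
    show "joined E B k0 b"
    proof (cases "b \<in> K")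
      case False
      then obtain i where i: "i < 3" "b \<in> set (zs i)" using b unfolding B_def by auto
      obtain k where k: "k \<in> K" "{k, last (T i)} \<in> E" using T(6)[OF i(1)] by blast
      show ?thesis
      proof (rule joined_along[of E "rev (zs i)"])
        show "successively (\<lambda>a b. {a, b} \<in> E) (rev (zs i))"
          using succ(2)[OF i(1)] by (simp add: insert_commute)
        show "set (rev (zs i)) \<subseteq> B" unfolding B_def using i(1) by auto
        show "joined E B k0 k" using base k(1) .
        show "rev (zs i) \<noteq> [] \<Longrightarrow> {k, hd (rev (zs i))} \<in> E"
          using k(2) unfolding split[OF i(1)] by (simp add: hd_rev)
        show "b \<in> set (rev (zs i))" using i(2) by simp
      qed
    qed (rule base)
  qed
  have C: "connected_in E C"
  proof (rule connected_inI[of _ _ q])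
    fix b assume "b \<in> C"
    then obtain i where i: "i < 3" "joined E (R i - set (T i)) q b" unfolding C_def by auto
    from i(2) have "joined E {c. joined E (R i - set (T i)) q c} q b"
    proof (induction rule: joined_induct)
      case refl
      then show ?case by (auto intro!: joined_refl)
    next
      case (step b c)
      then show ?case by (auto intro: joined_step)
    qed
    then show "joined E C q b" by (rule joined_mono) (use i(1) in \<open>auto simp: C_def\<close>)
  qed
  show False
  proof (rule no_K33_minor[OF simple emb, of A B C "p 0" "p 1" "p 2"])
    show "A \<subseteq> V" unfolding A_def using X(1) ysT(1) XT(3) by blast
    show "B \<subseteq> V" unfolding B_def using K(1) ysT(2) XT(3) by blast
    show "C \<subseteq> V" using CR XT(6) by blast
    show "A \<inter> B = {}"
    proof (rule equals0I)
      fix v assume "v \<in> A \<inter> B"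
      then consider "v \<in> X" "v \<in> K" | j where "j < 3" "v \<in> X" "v \<in> set (zs j)"
        | i where "i < 3" "v \<in> set (ys i)" "v \<in> K" | i j where "i < 3" "j < 3" "v \<in> set (ys i)" "v \<in> set (zs j)"
        unfolding A_def B_def by blast
      then show False
      proof cases
        case 1
        then show False using XK by blast
      next
        case 2
        then show False using XT(1)[of j] ysT(2)[of j] by blast
      next
        case 3
        then show False using XT(2)[of i] ysT(1)[of i] by blast
      next
        case 4
        then show False using dis[of i j] by blast
      qed
    qed
    show "A \<inter> C = {}"
    proof -
      have "X \<inter> C = {}" using CR XT(4) by blast
      moreover have "set (ys i) \<inter> C = {}" if "i < 3" for i using CT[OF that] ysT(1)[OF that] by blast
      ultimately show ?thesis unfolding A_def by blast
    qed
    show "B \<inter> C = {}"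
    proof -
      have "K \<inter> C = {}" using CR XT(5) by blast
      moreover have "set (zs i) \<inter> C = {}" if "i < 3" for i using CT[OF that] ysT(2)[OF that] by blast
      ultimately show ?thesis unfolding B_def by blast
    qed
    show "connected_in E A" "connected_in E B" "connected_in E C" by fact+
    show "p 0 \<noteq> p 1" "p 0 \<noteq> p 2" "p 1 \<noteq> p 2" by (rule pne; simp)+
    have "p i \<notin> A \<union> B \<union> C" if i: "i < 3" for i
    proof -
      have "p i \<notin> X" "p i \<notin> K" "p i \<notin> C" using pT[OF i] XT(1,2)[OF i] CT[OF i] by blast+
      then show ?thesis unfolding A_def B_def using pout[OF i] by blast
    qed
    then show "{p 0, p 1, p 2} \<inter> (A \<union> B \<union> C) = {}" by simp
    have nA: "\<exists>z\<in>A. {z, p i} \<in> E" if i: "i < 3" for i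
    proof (cases "ys i = []")
      case True
      then show ?thesis using T(5)[OF i] unfolding split[OF i] A_def by auto
    next
      case False
      then have "last (ys i) \<in> A" unfolding A_def using i last_in_set[OF False] by blast
      then show ?thesis using succ(3)[OF i False] by blast
    qed
    have nB: "\<exists>z\<in>B. {z, p i} \<in> E" if i: "i < 3" for i
    proof (cases "zs i = []")
      case True
      then show ?thesis using T(6)[OF i] unfolding split[OF i] B_def by auto
    next
      case False
      then have "hd (zs i) \<in> B" unfolding B_def using i hd_in_set[OF False] by blast
      then show ?thesis using succ(4)[OF i False] by (metis insert_commute)
    qed
    have nC: "\<exists>z\<in>C. {z, p i} \<in> E" if i: "i < 3" for i
      using c[OF i] cp[OF i] i unfolding C_def by blast
    show "\<exists>z\<in>Z. {z, v} \<in> E" if "Z \<in> {A, B, C}" "v \<in> {p 0, p 1, p 2}" for Z v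
    proof -
      have "\<exists>i<3. v = p i"
        using that(2) by (auto intro: exI[of _ "0::nat"] exI[of _ "1::nat"] exI[of _ "2::nat"])
      then show ?thesis using that(1) nA nB nC by blast
    qed
  qed
qed

end

section \<open>The load of a flow\<close>

text \<open>
  Connectedness is expressed by the vertex \<open>x\<close> from which everything is reached. The flow has strength \<open>1\<close> so
  that the weights of the paths into which it decomposes are probabilities.
\<close>

locale unit_flow = network +
  fixes x :: 'a and f :: "'a set \<Rightarrow> real"
  assumes x: "x \<in> V" and conn: "z \<in> V \<Longrightarrow> joined E V x z"
    and div0: "z \<in> V \<Longrightarrow> z \<noteq> x \<Longrightarrow> divergence E tail head f z = 0"
    and divx: "divergence E tail head f x = 1"
    and weighted: "(\<lambda>e. ((real (vertex_degree E (tail e)))\<^sup>2 + (real (vertex_degree E (head e)))\<^sup>2) * (f e)\<^sup>2) summable_on E"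
begin

definition load :: "'a \<Rightarrow> real" where
  "load v = (\<Sum>e\<in>incident_edges E v. \<bar>f e\<bar>)"

lemma load_nonneg: "0 \<le> load v"
  unfolding load_def by (simp add: sum_nonneg)

definition bound :: real where
  "bound = (\<Sum>\<^sub>\<infinity>e\<in>E. ((real (vertex_degree E (tail e)))\<^sup>2 + (real (vertex_degree E (head e)))\<^sup>2) * (f e)\<^sup>2)"

lemma weighted_sum_le:
  assumes "finite A" "A \<subseteq> E"
  shows "(\<Sum>e\<in>A. ((real (vertex_degree E (tail e)))\<^sup>2 + (real (vertex_degree E (head e)))\<^sup>2) * (f e)\<^sup>2) \<le> bound"
  unfolding bound_def by (rule finite_sum_le_infsum) (use assms weighted in auto)

lemma degree_pos: "e \<in> E \<Longrightarrow> v \<in> e \<Longrightarrow> 1 \<le> vertex_degree E v"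
  unfolding vertex_degree_def using finite_incident[of v]
  by (auto simp: incident_edges_def Suc_le_eq card_gt_0_iff)

lemma sum_f_le:
  assumes "finite A" "A \<subseteq> E"
  shows "(\<Sum>e\<in>A. (f e)\<^sup>2) \<le> bound"
proof -
  have "(\<Sum>e\<in>A. (f e)\<^sup>2) \<le> (\<Sum>e\<in>A. ((real (vertex_degree E (tail e)))\<^sup>2 + (real (vertex_degree E (head e)))\<^sup>2) * (f e)\<^sup>2)"
  proof (rule sum_mono)
    fix e assume "e \<in> A"
    then have "1 \<le> vertex_degree E (tail e)" using assms degree_pos[of e "tail e"] edge_ends[of e] by auto
    then have "1 \<le> (real (vertex_degree E (tail e)))\<^sup>2" by (simp add: one_le_power)
    then have "1 \<le> (real (vertex_degree E (tail e)))\<^sup>2 + (real (vertex_degree E (head e)))\<^sup>2" by (simp add: add_increasing2)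
    then show "(f e)\<^sup>2 \<le> ((real (vertex_degree E (tail e)))\<^sup>2 + (real (vertex_degree E (head e)))\<^sup>2) * (f e)\<^sup>2"
      using mult_right_mono[of 1 _ "(f e)\<^sup>2"] by simp
  qed
  then show ?thesis using weighted_sum_le[OF assms] by linarith
qed

lemma bound_nonneg: "0 \<le> bound"
  using weighted_sum_le[of "{}"] by simp

text \<open>
  Cauchy-Schwarz at a vertex costs one factor \<open>deg v\<close>; together with the factor \<open>deg v\<close> on the left this gives
  the weights of the hypothesis.
\<close>

lemma degree_load_le:
  assumes "finite W"
  shows "(\<Sum>v\<in>W. vertex_degree E v * (load v)\<^sup>2) \<le> bound"
proof -
  have "(\<Sum>v\<in>W. vertex_degree E v * (load v)\<^sup>2) \<le>
      (\<Sum>v\<in>W. (real (vertex_degree E v))\<^sup>2 * (\<Sum>e\<in>incident_edges E v. (f e)\<^sup>2))"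
  proof (rule sum_mono)
    fix v
    have "(load v)\<^sup>2 \<le> vertex_degree E v * (\<Sum>e\<in>incident_edges E v. (f e)\<^sup>2)"
      using sum_squared_le_sum_of_squares[of "\<lambda>e. \<bar>f e\<bar>" "incident_edges E v"]
      unfolding load_def vertex_degree_def by (simp add: mult.commute)
    then show "vertex_degree E v * (load v)\<^sup>2 \<le> (real (vertex_degree E v))\<^sup>2 * (\<Sum>e\<in>incident_edges E v. (f e)\<^sup>2)"
      using mult_left_mono[of _ _ "real (vertex_degree E v)"] by (simp add: power2_eq_square mult.assoc)
  qed
  also have "\<dots> \<le> (\<Sum>e\<in>{e \<in> E. e \<inter> W \<noteq> {}}. ((real (vertex_degree E (tail e)))\<^sup>2 + (real (vertex_degree E (head e)))\<^sup>2) * (f e)\<^sup>2)"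
    by (rule sum_incident_le[OF assms]) auto
  also have "\<dots> \<le> bound" using finite_touching[OF assms] by (intro weighted_sum_le) auto
  finally show ?thesis .
qed

lemma load_square_le_degree: "(load v)\<^sup>2 \<le> vertex_degree E v * (load v)\<^sup>2"
proof (cases "incident_edges E v = {}")
  case True
  then show ?thesis by (simp add: load_def)
next
  case False
  then have "1 \<le> vertex_degree E v" unfolding vertex_degree_def using finite_incident[of v]
    by (simp add: Suc_le_eq card_gt_0_iff)
  then show ?thesis using mult_right_mono[of 1 "real (vertex_degree E v)" "(load v)\<^sup>2"] by simp
qed

text \<open>
  A function that is Lipschitz for the vertex metric \<open>load\<close>, except on finitely many edges, has finite energy: by
  double counting, the sum of the squared increments is controlled by the sum of \<open>deg v * (load v)\<^sup>2\<close>.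
\<close>

lemma finite_energy_lipschitz:
  assumes B: "finite B" "B \<subseteq> E" and lip: "\<And>e. e \<in> E - B \<Longrightarrow> \<bar>grad u e\<bar> \<le> load (tail e) + load (head e)"
  shows "finite_energy E tail head u"
  unfolding finite_energy_iff
proof (rule nonneg_bdd_above_summable_on)
  show "bdd_above (sum (\<lambda>e. (grad u e)\<^sup>2) ` {F. F \<subseteq> E \<and> finite F})"
  proof (rule bdd_aboveI2)
    fix A assume A: "A \<in> {F. F \<subseteq> E \<and> finite F}"
    have "(\<Sum>e\<in>A. (grad u e)\<^sup>2) = (\<Sum>e\<in>A \<inter> B. (grad u e)\<^sup>2) + (\<Sum>e\<in>A - B. (grad u e)\<^sup>2)"
      using A by (simp add: sum.Int_Diff)
    also have "(\<Sum>e\<in>A \<inter> B. (grad u e)\<^sup>2) \<le> (\<Sum>e\<in>B. (grad u e)\<^sup>2)"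
      using B by (intro sum_mono2) auto
    also have "(\<Sum>e\<in>A - B. (grad u e)\<^sup>2) \<le> (\<Sum>e\<in>A - B. 2 * ((load (tail e))\<^sup>2 + (load (head e))\<^sup>2))"
    proof (rule sum_mono)
      fix e assume "e \<in> A - B"
      then have "\<bar>grad u e\<bar> \<le> load (tail e) + load (head e)" using A lip by auto
      then have "(grad u e)\<^sup>2 \<le> (load (tail e) + load (head e))\<^sup>2"
        by (metis abs_le_square_iff abs_of_nonneg add_nonneg_nonneg load_nonneg)
      moreover have "0 \<le> (load (tail e) - load (head e))\<^sup>2" by simp
      ultimately show "(grad u e)\<^sup>2 \<le> 2 * ((load (tail e))\<^sup>2 + (load (head e))\<^sup>2)"
        by (simp add: power2_eq_square algebra_simps)
    qed
    also have "\<dots> = 2 * (\<Sum>e\<in>A - B. (load (tail e))\<^sup>2 + (load (head e))\<^sup>2)" by (simp add: sum_distrib_left)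
    also have "\<dots> \<le> 2 * (\<Sum>v\<in>\<Union>(A - B). vertex_degree E v * (load v)\<^sup>2)"
      using degree_weighted_sum[of "A - B" "\<lambda>v. (load v)\<^sup>2"] A by auto
    also have "\<dots> \<le> 2 * bound"
    proof -
      have "finite (\<Union>(A - B))" using A edge(1) by (metis (no_types, lifting) Diff_subset finite.simps finite_Diff finite_Union mem_Collect_eq subsetD)
      from degree_load_le[OF this] show ?thesis by simp
    qed
    finally show "(\<Sum>e\<in>A. (grad u e)\<^sup>2) \<le> (\<Sum>e\<in>B. (grad u e)\<^sup>2) + 2 * bound" by simp
  qed
qed auto

lemma load_square_tail:
  assumes "0 < \<alpha>"
  obtains Y where "finite Y" "Y \<subseteq> V" "\<And>W. finite W \<Longrightarrow> W \<subseteq> V - Y \<Longrightarrow> (\<Sum>v\<in>W. (load v)\<^sup>2) \<le> \<alpha>"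
proof -
  have le: "(\<Sum>v\<in>W. (load v)\<^sup>2) \<le> bound" if "finite W" for W
    using sum_mono[of W "\<lambda>v. (load v)\<^sup>2" "\<lambda>v. vertex_degree E v * (load v)\<^sup>2"] load_square_le_degree degree_load_le[OF that] by fastforce
  have summ: "(\<lambda>v. (load v)\<^sup>2) summable_on V"
    by (rule nonneg_bdd_above_summable_on) (auto intro!: bdd_aboveI2[where M = bound] le)
  define s where "s = (\<Sum>\<^sub>\<infinity>v\<in>V. (load v)\<^sup>2)"
  have "(sum (\<lambda>v. (load v)\<^sup>2) \<longlongrightarrow> s) (finite_subsets_at_top V)"
    unfolding s_def using summ by (rule infsum_tendsto)
  then have "\<forall>\<^sub>F Y in finite_subsets_at_top V. s - \<alpha> < (\<Sum>v\<in>Y. (load v)\<^sup>2)"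
    by (rule order_tendstoD) (use assms in simp)
  then obtain Y where Y: "finite Y" "Y \<subseteq> V" "s - \<alpha> < (\<Sum>v\<in>Y. (load v)\<^sup>2)"
    unfolding eventually_finite_subsets_at_top by blast
  show thesis
  proof (rule that[OF Y(1,2)])
    fix W assume W: "finite W" "W \<subseteq> V - Y"
    have "(\<Sum>v\<in>Y. (load v)\<^sup>2) + (\<Sum>v\<in>W. (load v)\<^sup>2) = (\<Sum>v\<in>Y \<union> W. (load v)\<^sup>2)"
      using W Y by (intro sum.union_disjoint[symmetric]) auto
    also have "\<dots> \<le> s" unfolding s_def using W Y summ by (intro finite_sum_le_infsum) auto
    finally show "(\<Sum>v\<in>W. (load v)\<^sup>2) \<le> \<alpha>" using Y(3) by simp
  qed
qed

lemma finite_connected_superset: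
  assumes "finite Y" "Y \<subseteq> V"
  obtains X where "finite X" "X \<subseteq> V" "Y \<subseteq> X" "x \<in> X" "connected_in E X"
proof -
  have "\<exists>R. finite R \<and> R \<subseteq> V \<and> y \<in> R \<and> (\<forall>r\<in>R. joined E R x r)" if "y \<in> Y" for y
    using joined_finite[OF conn] that assms(2) by blast
  then obtain R where R: "\<And>y. y \<in> Y \<Longrightarrow> finite (R y) \<and> R y \<subseteq> V \<and> y \<in> R y \<and> (\<forall>r\<in>R y. joined E (R y) x r)"
    by metis
  define X where "X = insert x (\<Union>y\<in>Y. R y)"
  show thesis
  proof
    show "finite X" "X \<subseteq> V" "Y \<subseteq> X" "x \<in> X" unfolding X_def using R assms x by auto
    show "connected_in E X"
    proof (rule connected_inI[of _ _ x])
      fix b assume "b \<in> X"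
      then consider "b = x" | y where "y \<in> Y" "b \<in> R y" unfolding X_def by auto
      then show "joined E X x b"
      proof cases
        case 1
        then show ?thesis unfolding X_def by (auto intro: joined_refl)
      next
        case 2
        then have "joined E (R y) x b" using R by blast
        then show ?thesis by (rule joined_mono) (use 2 in \<open>auto simp: X_def\<close>)
      qed
    qed
  qed
qed

section \<open>Random paths carried by the flow\<close>

text \<open>
  The flow as an antisymmetric function of ordered pairs, independent of the orientation of the edges.
\<close>

definition arc_flow :: "'a \<Rightarrow> 'a \<Rightarrow> real" where
  "arc_flow a b = (if {a, b} \<in> E then if tail {a, b} = a then f {a, b} else - f {a, b} else 0)"

lemma arc_flow_anti: "arc_flow a b = - arc_flow b a"
  using edge_cases[of a b] edge_pair[of a b] unfolding arc_flow_def by (auto simp: insert_commute)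

lemma arc_flow_abs: "{a, b} \<in> E \<Longrightarrow> \<bar>arc_flow a b\<bar> = \<bar>f {a, b}\<bar>"
  unfolding arc_flow_def by simp

lemma divergence_arc_flow: "divergence E tail head f z = (\<Sum>y\<in>neighbours E z. arc_flow z y)"
proof -
  define g where "g = (\<lambda>e. if tail e = z then f e else - f e)"
  have fin: "finite {e \<in> E. tail e = z}" "finite {e \<in> E. head e = z}"
    by (rule finite_subset[OF _ finite_incident[of z]]; use edge_ends in \<open>auto simp: incident_edges_def\<close>)+
  have "divergence E tail head f z = (\<Sum>e\<in>{e \<in> E. tail e = z}. g e) + (\<Sum>e\<in>{e \<in> E. head e = z}. g e)"
  proof -
    have "(\<Sum>e\<in>{e \<in> E. tail e = z}. g e) = (\<Sum>e\<in>{e \<in> E. tail e = z}. f e)"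
      by (rule sum.cong) (auto simp: g_def)
    moreover have "(\<Sum>e\<in>{e \<in> E. head e = z}. g e) = (\<Sum>e\<in>{e \<in> E. head e = z}. - f e)"
      by (rule sum.cong) (use edge(2) in \<open>auto simp: g_def\<close>)
    ultimately show ?thesis unfolding divergence_def by (simp add: sum_negf)
  qed
  also have "\<dots> = (\<Sum>e\<in>{e \<in> E. tail e = z} \<union> {e \<in> E. head e = z}. g e)"
    using edge(2) by (intro sum.union_disjoint[symmetric] fin) force
  also have "{e \<in> E. tail e = z} \<union> {e \<in> E. head e = z} = incident_edges E z"
    using edge_ends unfolding incident_edges_def by auto
  also have "(\<Sum>e\<in>incident_edges E z. g e) = (\<Sum>y\<in>neighbours E z. g {z, y})" by (rule sum_incident)
  also have "\<dots> = (\<Sum>y\<in>neighbours E z. arc_flow z y)"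
    by (rule sum.cong) (auto simp: g_def arc_flow_def neighbours_def)
  finally show ?thesis .
qed


definition source_path :: "'a list \<Rightarrow> bool" where
  "source_path P \<longleftrightarrow> P \<noteq> [] \<and> distinct P \<and> hd P = x \<and> successively (\<lambda>a b. {a, b} \<in> E) P"

lemma path_edges_in_E: "source_path P \<Longrightarrow> path_edges P \<subseteq> E"
  unfolding source_path_def successively_iff_steps path_edges_def by auto

lemma path_vertices: "source_path P \<Longrightarrow> set P \<subseteq> V"
proof
  fix v assume P: "source_path P" and v: "v \<in> set P"
  show "v \<in> V"
  proof (cases "v \<in> set (tl P)")
    case True
    then obtain a where "(a, v) \<in> steps P" using tl_steps by fast
    then have "{a, v} \<in> E" using path_edges_in_E[OF P] unfolding path_edges_def by auto
    then show ?thesis using edge_pair by blast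
  next
    case False
    then have "v = x" using P v unfolding source_path_def by (cases P) auto
    then show ?thesis using x by simp
  qed
qed

text \<open>
  The law of a random path, given by weights on a finite set of paths, so that expectations are finite sums. The
  last two clauses bound the probabilities of using an edge and of visiting a vertex.
\<close>

definition path_distribution :: "'a set \<Rightarrow> 'a list set \<Rightarrow> ('a list \<Rightarrow> real) \<Rightarrow> bool" where
  "path_distribution W PP c \<longleftrightarrow> finite PP \<and> (\<forall>P\<in>PP. source_path P \<and> last P \<notin> W) \<and> (\<forall>P. 0 \<le> c P) \<and> sum c PP = 1 \<and>
     (\<forall>e\<in>E. (\<Sum>P | P \<in> PP \<and> e \<in> path_edges P. c P) \<le> \<bar>f e\<bar>) \<and>
     (\<forall>v\<in>V. (\<Sum>P | P \<in> PP \<and> v \<in> set P. c P) \<le> load v)"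

lemma path_distributionD:
  assumes "path_distribution W PP c"
  shows "finite PP" "\<And>P. P \<in> PP \<Longrightarrow> source_path P" "\<And>P. P \<in> PP \<Longrightarrow> last P \<notin> W" "\<And>P. 0 \<le> c P" "sum c PP = 1"
    "\<And>e. e \<in> E \<Longrightarrow> (\<Sum>P | P \<in> PP \<and> e \<in> path_edges P. c P) \<le> \<bar>f e\<bar>"
    "\<And>v. v \<in> V \<Longrightarrow> (\<Sum>P | P \<in> PP \<and> v \<in> set P. c P) \<le> load v"
  using assms unfolding path_distribution_def by simp_all

lemma path_distribution_exists:
  assumes W: "finite W" "W \<subseteq> V" "x \<in> W"
  shows "\<exists>PP c. path_distribution W PP c"
proof -
  define U where "U = W \<union> (\<Union>v\<in>W. neighbours E v)"
  have U: "finite U" "W \<subseteq> U" unfolding U_def using W(1) finite_neighbours by auto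
  have supp: "b \<in> U" if "a \<in> W" "arc_flow a b \<noteq> 0" for a b
    using that unfolding U_def arc_flow_def neighbours_def by (auto split: if_splits)
  have div: "(\<Sum>b\<in>U. arc_flow a b) = divergence E tail head f a" if "a \<in> W" for a
    unfolding divergence_arc_flow
    by (rule sum.mono_neutral_right) (use U that in \<open>auto simp: U_def arc_flow_def neighbours_def\<close>)
  have d0: "(\<Sum>b\<in>U. arc_flow a b) = 0" if "a \<in> W" "a \<noteq> x" for a using div[OF that(1)] div0 that W(2) by auto
  have d1: "(\<Sum>b\<in>U. arc_flow x b) = 1" using div[OF W(3)] divx by simp
  have "\<exists>PP c. finite PP \<and> (\<forall>P\<in>PP. exit_path arc_flow W x P) \<and> (\<forall>P. 0 \<le> c P) \<and> sum c PP = 1 \<and>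
     (\<forall>a b. (\<Sum>P | P \<in> PP \<and> (a, b) \<in> steps P. c P) \<le> max 0 (arc_flow a b))"
    by (rule flow_path_decomposition[OF W(1) U W(3)]) (fact arc_flow_anti, fact supp, fact d0, fact d1, simp)
  then obtain PP c where PP: "finite PP" and exit: "\<forall>P\<in>PP. exit_path arc_flow W x P" and c: "\<forall>P. 0 \<le> c P"
    and c1: "sum c PP = 1" and st: "\<forall>a b. (\<Sum>P | P \<in> PP \<and> (a, b) \<in> steps P. c P) \<le> max 0 (arc_flow a b)"
    by (elim exE conjE) (rule that; assumption)
  have path: "source_path P" "last P \<notin> W" if "P \<in> PP" for P
  proof -
    have P: "exit_path arc_flow W x P" using exit that by blast
    have "{a, b} \<in> E" if "(a, b) \<in> steps P" for a b
    proof -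
      have "0 < arc_flow a b" using P that unfolding exit_path_def by blast
      then show ?thesis unfolding arc_flow_def by (auto split: if_splits)
    qed
    then show "source_path P" "last P \<notin> W"
      using P unfolding exit_path_def source_path_def successively_iff_steps by auto
  qed
  have edge_le: "(\<Sum>P | P \<in> PP \<and> e \<in> path_edges P. c P) \<le> \<bar>f e\<bar>" if e: "e \<in> E" for e
  proof -
    define a where "a = tail e"
    define b where "b = head e"
    have ab: "e = {a, b}" using edge(1)[OF e] unfolding a_def b_def .
    have "{P. P \<in> PP \<and> e \<in> path_edges P} \<subseteq> {P. P \<in> PP \<and> (a, b) \<in> steps P} \<union> {P. P \<in> PP \<and> (b, a) \<in> steps P}"
      unfolding path_edges_def ab by (auto simp: doubleton_eq_iff)
    then have "(\<Sum>P | P \<in> PP \<and> e \<in> path_edges P. c P) \<le> (\<Sum>P\<in>{P. P \<in> PP \<and> (a, b) \<in> steps P} \<union> {P. P \<in> PP \<and> (b, a) \<in> steps P}. c P)"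
      using PP c by (intro sum_mono2) auto
    also have "\<dots> \<le> (\<Sum>P | P \<in> PP \<and> (a, b) \<in> steps P. c P) + (\<Sum>P | P \<in> PP \<and> (b, a) \<in> steps P. c P)"
      using PP c by (subst sum.union_inter[symmetric]) (auto intro!: sum_nonneg)
    also have "\<dots> \<le> max 0 (arc_flow a b) + max 0 (arc_flow b a)" using st by (intro add_mono) auto
    also have "\<dots> = \<bar>arc_flow a b\<bar>" using arc_flow_anti[of b a] by simp
    also have "\<dots> = \<bar>f e\<bar>" using arc_flow_abs[of a b] e unfolding ab by simp
    finally show ?thesis .
  qed
  have vertex_le: "(\<Sum>P | P \<in> PP \<and> v \<in> set P. c P) \<le> load v" if v: "v \<in> V" for v
  proof -
    have hit: "\<exists>e\<in>incident_edges E v. e \<in> path_edges P" if P: "P \<in> PP" "v \<in> set P" for P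
    proof -
      have "v \<in> set (butlast P) \<or> v \<in> set (tl P)"
      proof -
        have "P \<noteq> [a]" for a using path[OF P(1)] W(3) unfolding source_path_def by auto
        then obtain a b Q where "P = a # b # Q" using P(2) by (metis list.exhaust list.set(1) empty_iff)
        then show ?thesis using P(2) by auto
      qed
      then obtain a b where "(a, b) \<in> steps P" "v = a \<or> v = b" using butlast_steps tl_steps by metis
      then have "{a, b} \<in> path_edges P" "v \<in> {a, b}" unfolding path_edges_def by auto
      then show ?thesis using path_edges_in_E[OF path(1)[OF P(1)]] unfolding incident_edges_def by blast
    qed
    have "(\<Sum>P | P \<in> PP \<and> v \<in> set P. c P) \<le> (\<Sum>P | P \<in> PP \<and> v \<in> set P. \<Sum>e\<in>{e \<in> incident_edges E v. e \<in> path_edges P}. c P)"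
    proof (rule sum_mono)
      fix P assume "P \<in> {P. P \<in> PP \<and> v \<in> set P}"
      then obtain e where "e \<in> incident_edges E v" "e \<in> path_edges P" using hit by blast
      then show "c P \<le> (\<Sum>e\<in>{e \<in> incident_edges E v. e \<in> path_edges P}. c P)"
        using member_le_sum[of e "{e \<in> incident_edges E v. e \<in> path_edges P}" "\<lambda>_. c P"] c finite_incident by auto
    qed
    also have "\<dots> \<le> (\<Sum>P\<in>PP. \<Sum>e\<in>{e \<in> incident_edges E v. e \<in> path_edges P}. c P)"
      using PP c by (intro sum_mono2) (auto intro: sum_nonneg)
    also have "\<dots> = (\<Sum>e\<in>incident_edges E v. \<Sum>P | P \<in> PP \<and> e \<in> path_edges P. c P)"
      by (rule sum.swap_restrict[OF PP finite_incident])
    also have "\<dots> \<le> load v"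
      unfolding load_def by (intro sum_mono edge_le) (auto simp: incident_edges_def)
    finally show ?thesis .
  qed
  have "path_distribution W PP c"
    unfolding path_distribution_def
  proof (intro conjI ballI)
    show "source_path P" "last P \<notin> W" if "P \<in> PP" for P using path[OF that] by auto
  qed (use PP c c1 edge_le vertex_le in simp_all)
  then show ?thesis by blast
qed

text \<open>
  The vertices of the path are distinct, so the telescoping sum meets each edge of the set only once.
\<close>

lemma path_variation:
  assumes "successively (\<lambda>a b. {a, b} \<in> E) P" "distinct P" "p \<in> set P"
  shows "\<bar>g p - g (hd P)\<bar> \<le> (\<Sum>e\<in>path_edges P. \<bar>grad g e\<bar>)"
  using assms
proof (induction P rule: induct_list012)
  case (3 a b Q)
  have new: "{a, b} \<notin> path_edges (b # Q)" using path_edges_vertices[of "{a, b}" "b # Q"] 3(4) by auto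
  have ge: "\<bar>g b - g a\<bar> = \<bar>grad g {a, b}\<bar>" using 3(3) grad_pair[of a b g] by (simp add: abs_minus_commute)
  show ?case
  proof (cases "p = a")
    case True
    then show ?thesis by (simp add: sum_nonneg)
  next
    case False
    then have "\<bar>g p - g b\<bar> \<le> (\<Sum>e\<in>path_edges (b # Q). \<bar>grad g e\<bar>)" using 3 by simp
    then show ?thesis using new ge by simp
  qed
qed auto

text \<open>
  Outside the finite set \<open>F\<close>, a path from \<open>x\<close> sees the constant \<open>c j\<close> as value of \<open>u j\<close>, up to its \<open>\<rho>\<close>-length. The third
  clause makes the expected \<open>\<rho>\<close>-length of the random path at most \<open>\<sigma>\<close>. One edge length \<open>\<rho>\<close> serves all
  the functions indexed by \<open>J\<close>.
\<close>

definition path_test ::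
    "'j set \<Rightarrow> ('j \<Rightarrow> 'a \<Rightarrow> real) \<Rightarrow> real \<Rightarrow> 'a set \<Rightarrow> ('j \<Rightarrow> real) \<Rightarrow> ('a set \<Rightarrow> real) \<Rightarrow> bool" where
  "path_test J u \<sigma> F c \<rho> \<longleftrightarrow> finite F \<and> (\<forall>e. 0 \<le> \<rho> e) \<and>
     (\<forall>A. finite A \<longrightarrow> A \<subseteq> E \<longrightarrow> (\<Sum>e\<in>A. \<rho> e * \<bar>f e\<bar>) \<le> \<sigma>) \<and>
     (\<forall>P p j. source_path P \<longrightarrow> p \<in> set P \<longrightarrow> p \<notin> F \<longrightarrow> j \<in> J \<longrightarrow> \<bar>u j p - c j\<bar> \<le> (\<Sum>e\<in>path_edges P. \<rho> e))"

lemma path_testD: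
  assumes "path_test J u \<sigma> F c \<rho>"
  shows "finite F" "\<And>e. 0 \<le> \<rho> e"
    "\<And>A. finite A \<Longrightarrow> A \<subseteq> E \<Longrightarrow> (\<Sum>e\<in>A. \<rho> e * \<bar>f e\<bar>) \<le> \<sigma>"
    "\<And>P p j. source_path P \<Longrightarrow> p \<in> set P \<Longrightarrow> p \<notin> F \<Longrightarrow> j \<in> J \<Longrightarrow> \<bar>u j p - c j\<bar> \<le> (\<Sum>e\<in>path_edges P. \<rho> e)"
  using assms unfolding path_test_def by simp_all

text \<open>
  Approximate \<open>u j\<close> by a finitely supported \<open>\<phi> j\<close>, let \<open>F\<close> be the union of the supports and let \<open>\<rho>\<close> be the sum of the moduli of
  the gradients of \<open>u j - \<phi> j\<close>. Outside \<open>F\<close> the function \<open>u j\<close> is \<open>u j - \<phi> j\<close>, which changes along a path by at most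
  the \<open>\<rho>\<close>-length; so \<open>c j\<close> is the value of \<open>u j - \<phi> j\<close> at \<open>x\<close>.
\<close>

lemma path_test_exists:
  fixes u :: "'j \<Rightarrow> 'a \<Rightarrow> real"
  assumes trivial: "\<And>h. dirichlet_harmonic V E tail head h \<Longrightarrow> h constant_on V"
    and deg: "\<And>z. z \<in> V \<Longrightarrow> neighbours E z \<noteq> {}"
    and J: "finite J" and fe: "\<And>j. j \<in> J \<Longrightarrow> finite_energy E tail head (u j)" and \<sigma>: "0 < \<sigma>"
  shows "\<exists>F c \<rho>. path_test J u \<sigma> F c \<rho>"
proof -
  define \<tau> where "\<tau> = \<sigma> / (1 + card J)"
  have \<tau>: "0 < \<tau>" unfolding \<tau>_def using \<sigma> by simp
  define \<epsilon> where "\<epsilon> = \<tau>\<^sup>2 / (1 + bound)"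
  have \<epsilon>: "0 < \<epsilon>" unfolding \<epsilon>_def using \<tau> bound_nonneg by simp
  have \<epsilon>b: "\<epsilon> * bound \<le> \<tau>\<^sup>2"
    unfolding \<epsilon>_def using bound_nonneg by (simp add: field_simps)
  have "\<exists>\<phi>. finite {v. \<phi> v \<noteq> 0} \<and> finite_energy E tail head (\<lambda>v. u j v - \<phi> v) \<and> energy (\<lambda>v. u j v - \<phi> v) \<le> \<epsilon>"
    if "j \<in> J" for j
    using finitely_supported_approximation[OF x conn deg trivial fe[OF that] \<epsilon>] by blast
  then have "\<exists>\<phi>. \<forall>j\<in>J. finite {v. \<phi> j v \<noteq> 0} \<and> finite_energy E tail head (\<lambda>v. u j v - \<phi> j v) \<and> energy (\<lambda>v. u j v - \<phi> j v) \<le> \<epsilon>"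
    by (intro bchoice ballI)
  then obtain \<phi> where \<phi>: "\<And>j. j \<in> J \<Longrightarrow> finite {v. \<phi> j v \<noteq> 0}"
     "\<And>j. j \<in> J \<Longrightarrow> finite_energy E tail head (\<lambda>v. u j v - \<phi> j v)"
     "\<And>j. j \<in> J \<Longrightarrow> energy (\<lambda>v. u j v - \<phi> j v) \<le> \<epsilon>" by blast
  define g where "g = (\<lambda>j v. u j v - \<phi> j v)"
  define \<rho> where "\<rho> = (\<lambda>e. \<Sum>j\<in>J. \<bar>grad (g j) e\<bar>)"
  define F where "F = (\<Union>j\<in>J. {v. \<phi> j v \<noteq> 0})"
  have "path_test J u \<sigma> F (\<lambda>j. g j x) \<rho>"
    unfolding path_test_def
  proof (intro conjI allI impI)
    show "finite F" unfolding F_def using J \<phi>(1) by simp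
    show "0 \<le> \<rho> e" for e unfolding \<rho>_def by (simp add: sum_nonneg)
    show "(\<Sum>e\<in>A. \<rho> e * \<bar>f e\<bar>) \<le> \<sigma>" if A: "finite A" "A \<subseteq> E" for A
    proof -
      have one: "(\<Sum>e\<in>A. \<bar>grad (g j) e\<bar> * \<bar>f e\<bar>) \<le> \<tau>" if j: "j \<in> J" for j
      proof -
        have "(\<Sum>e\<in>A. \<bar>grad (g j) e\<bar> * \<bar>f e\<bar>)\<^sup>2 \<le> (\<Sum>e\<in>A. \<bar>grad (g j) e\<bar>\<^sup>2) * (\<Sum>e\<in>A. \<bar>f e\<bar>\<^sup>2)"
          by (rule Cauchy_Schwarz_ineq_sum)
        also have "\<dots> \<le> \<epsilon> * bound"
        proof (rule mult_mono)
          show "(\<Sum>e\<in>A. \<bar>grad (g j) e\<bar>\<^sup>2) \<le> \<epsilon>"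
            using sum_le_energy[OF \<phi>(2)[OF j] A] \<phi>(3)[OF j] unfolding g_def by simp
        qed (use sum_f_le[OF A] \<epsilon> in \<open>auto intro: sum_nonneg\<close>)
        also have "\<dots> \<le> \<tau>\<^sup>2" by (rule \<epsilon>b)
        finally show ?thesis using \<tau> by (meson less_imp_le power2_le_imp_le)
      qed
      have "(\<Sum>e\<in>A. \<rho> e * \<bar>f e\<bar>) = (\<Sum>j\<in>J. \<Sum>e\<in>A. \<bar>grad (g j) e\<bar> * \<bar>f e\<bar>)"
        unfolding \<rho>_def sum_distrib_right by (rule sum.swap)
      also have "\<dots> \<le> (\<Sum>j\<in>J. \<tau>)" by (intro sum_mono one)
      also have "\<dots> \<le> \<sigma>" unfolding \<tau>_def using \<sigma> by (simp add: field_simps)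
      finally show ?thesis .
    qed
    show "\<bar>u j p - g j x\<bar> \<le> (\<Sum>e\<in>path_edges P. \<rho> e)" if P: "source_path P" "p \<in> set P" "p \<notin> F" "j \<in> J" for P p j
    proof -
      have "u j p = g j p" using P unfolding F_def g_def by simp
      moreover have "\<bar>g j p - g j x\<bar> \<le> (\<Sum>e\<in>path_edges P. \<bar>grad (g j) e\<bar>)"
        using path_variation[of P p "g j"] P unfolding source_path_def by auto
      moreover have "(\<Sum>e\<in>path_edges P. \<bar>grad (g j) e\<bar>) \<le> (\<Sum>e\<in>path_edges P. \<rho> e)"
        unfolding \<rho>_def using P(4) J by (intro sum_mono member_le_sum) auto
      ultimately show ?thesis by simp
    qed
  qed
  then show ?thesis by blast
qed

section \<open>The test functions\<close>

text \<open>
  A distance outside \<open>X\<close> in which a vertex costs its load. It is capped at \<open>1\<close>, so vertices that cannot be joined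
  outside \<open>X\<close> have distance \<open>1\<close>; and it is measured by joining sets instead of walks, which gives the same
  infimum.
\<close>

definition avoiding_dist :: "'a set \<Rightarrow> 'a \<Rightarrow> 'a \<Rightarrow> real" where
  "avoiding_dist X v q = Inf (insert 1 {(\<Sum>r\<in>R. load r) | R. finite R \<and> R \<subseteq> V - X \<and> joined E R v q})"

lemma avoiding_dist_bdd: "bdd_below (insert 1 {(\<Sum>r\<in>R. load r) | R. finite R \<and> R \<subseteq> V - X \<and> joined E R v q})"
  by (rule bdd_belowI[of _ 0]) (auto intro: sum_nonneg load_nonneg)

lemma avoiding_dist_le: "finite R \<Longrightarrow> R \<subseteq> V - X \<Longrightarrow> joined E R v q \<Longrightarrow> avoiding_dist X v q \<le> (\<Sum>r\<in>R. load r)"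
  unfolding avoiding_dist_def by (rule cInf_lower[OF _ avoiding_dist_bdd]) auto

lemma avoiding_dist_le_1: "avoiding_dist X v q \<le> 1"
  unfolding avoiding_dist_def by (rule cInf_lower[OF _ avoiding_dist_bdd]) auto

lemma avoiding_dist_witness:
  assumes "avoiding_dist X v q < t" "t \<le> 1"
  shows "\<exists>R. finite R \<and> R \<subseteq> V - X \<and> joined E R v q \<and> (\<Sum>r\<in>R. load r) < t"
proof -
  have "\<exists>s\<in>insert 1 {(\<Sum>r\<in>R. load r) | R. finite R \<and> R \<subseteq> V - X \<and> joined E R v q}. s < t"
    using assms(1) cInf_less_iff[OF _ avoiding_dist_bdd] unfolding avoiding_dist_def by blast
  then show ?thesis using assms(2) by auto
qed

lemma avoiding_dist_step:
  assumes e: "{q, q'} \<in> E" and q': "q' \<notin> X"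
  shows "avoiding_dist X v q' \<le> avoiding_dist X v q + load q'"
proof -
  have "avoiding_dist X v q' - load q' \<le> avoiding_dist X v q"
    unfolding avoiding_dist_def[of X v q]
  proof (rule cInf_greatest)
    fix s assume "s \<in> insert 1 {(\<Sum>r\<in>R. load r) | R. finite R \<and> R \<subseteq> V - X \<and> joined E R v q}"
    then consider "s = 1" | R where "s = (\<Sum>r\<in>R. load r)" "finite R" "R \<subseteq> V - X" "joined E R v q" by blast
    then show "avoiding_dist X v q' - load q' \<le> s"
    proof cases
      case 1
      then show ?thesis using avoiding_dist_le_1[of X v q'] load_nonneg[of q'] by simp
    next
      case 2
      have "joined E (insert q' R) v q'"
        using joined_mono[OF 2(4), of "insert q' R"] e by (auto intro: joined_step)
      then have "avoiding_dist X v q' \<le> (\<Sum>r\<in>insert q' R. load r)"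
        using 2 q' edge_pair[OF e] by (intro avoiding_dist_le) auto
      also have "\<dots> \<le> (\<Sum>r\<in>R. load r) + load q'" using 2(2) load_nonneg[of q'] by (cases "q' \<in> R") (auto simp: insert_absorb)
      finally show ?thesis using 2(1) by simp
    qed
  qed simp
  then show ?thesis by simp
qed

text \<open>
  Only the finitely many edges that touch \<open>X\<close> can violate the Lipschitz condition.
\<close>

lemma finite_energy_avoiding_dist:
  assumes "finite X"
  shows "finite_energy E tail head (avoiding_dist X v)"
proof (rule finite_energy_lipschitz[OF finite_touching[OF assms]])
  fix e assume "e \<in> E - {e \<in> E. e \<inter> X \<noteq> {}}"
  then have e: "e \<in> E" "tail e \<notin> X" "head e \<notin> X" using edge_ends[of e] by auto
  have "{tail e, head e} \<in> E" "{head e, tail e} \<in> E" using edge(1)[OF e(1)] e(1) by (auto simp: insert_commute)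
  from avoiding_dist_step[OF this(1) e(3), of v] avoiding_dist_step[OF this(2) e(2), of v]
  show "\<bar>grad (avoiding_dist X v) e\<bar> \<le> load (tail e) + load (head e)"
    unfolding grad_def using load_nonneg[of "tail e"] load_nonneg[of "head e"] by linarith
qed auto

lemma finite_energy_component:
  assumes "finite F"
  shows "finite_energy E tail head (indicator {z. joined E (V - F) y z})"
proof (rule finite_energy_lipschitz[OF finite_touching[OF assms]])
  fix e assume "e \<in> E - {e \<in> E. e \<inter> F \<noteq> {}}"
  then have e: "e \<in> E" "tail e \<in> V - F" "head e \<in> V - F" using edge_ends[of e] edge(3,4)[of e] by auto
  have "{tail e, head e} \<in> E" "{head e, tail e} \<in> E" using edge(1)[OF e(1)] e(1) by (auto simp: insert_commute)
  then have "joined E (V - F) y (tail e) \<longleftrightarrow> joined E (V - F) y (head e)"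
    using e(2,3) by (metis joined_step)
  then show "\<bar>grad (indicator {z. joined E (V - F) y z}) e\<bar> \<le> load (tail e) + load (head e)"
    unfolding grad_def using load_nonneg[of "tail e"] load_nonneg[of "head e"] by (simp add: indicator_def)
qed auto

lemma path_leaves:
  assumes "source_path P" "x \<in> X" "last P \<notin> X"
  obtains P0 a L where "P = P0 @ a # L" "a \<in> X" "L \<noteq> []" "set L \<inter> X = {}" "last L = last P"
    "distinct L" "successively (\<lambda>a b. {a, b} \<in> E) L" "{a, hd L} \<in> E"
proof -
  have "\<exists>a\<in>set P. a \<in> X" using assms unfolding source_path_def by (metis hd_in_set)
  then obtain P0 a L where P: "P = P0 @ a # L" "a \<in> X" "\<forall>b\<in>set L. b \<notin> X"
    using split_list_last_prop[of P "\<lambda>a. a \<in> X"] by blast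
  have L: "L \<noteq> []" using P assms(3) by auto
  show thesis
    by (rule that[OF P(1,2) L]) (use P L assms(1) in \<open>auto simp: source_path_def successively_append_iff successively_Cons\<close>)
qed

section \<open>The contradiction\<close>

text \<open>
  Three independent random paths from \<open>x\<close> produce the configuration of \<open>no_three_arms\<close>. The finite sets are chosen
  in the order \<open>X \<subseteq> W1 \<subseteq> F \<subseteq> W2\<close>: the squares of the loads outside \<open>X\<close> have a negligible sum, outside \<open>W1\<close> the distances to the vertices next to
  \<open>X\<close> are almost deterministic, \<open>F\<close> contains all the connections to \<open>q\<close>, and outside \<open>W2\<close> the component of the complement of \<open>F\<close> is
  deterministic. The paths end outside \<open>W2\<close>.
\<close>

lemma not_planar_if_liouville:
  assumes trivial: "\<And>h. dirichlet_harmonic V E tail head h \<Longrightarrow> h constant_on V"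
    and deg: "\<And>z. z \<in> V \<Longrightarrow> neighbours E z \<noteq> {}"
    and planar: "planar_graph V E"
  shows False
proof -
  obtain pos \<gamma> where emb: "plane_embedding V E pos \<gamma>" using planar unfolding planar_graph_def by blast
  \<comment> \<open>Small enough for the first moment estimate: the expected total cost below is at most
     \<open>3 * 3/100 + 3 * (\<alpha> + 1/10) < 1\<close>.\<close>
  define \<alpha> :: real where "\<alpha> = 1 / 10000"
  have \<alpha>: "0 < \<alpha>" unfolding \<alpha>_def by simp
  obtain Y where Y: "finite Y" "Y \<subseteq> V" "\<And>W. finite W \<Longrightarrow> W \<subseteq> V - Y \<Longrightarrow> (\<Sum>v\<in>W. (load v)\<^sup>2) \<le> \<alpha>"
    using load_square_tail[OF \<alpha>] by blast
  obtain X where X: "finite X" "X \<subseteq> V" "Y \<subseteq> X" "x \<in> X" "connected_in E X"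
    using finite_connected_superset[OF Y(1,2)] by blast
  have tailX: "(\<Sum>v\<in>W. (load v)\<^sup>2) \<le> \<alpha>" if "finite W" "W \<subseteq> V - X" for W
    using Y(3)[of W] that X(3) by blast
  \<comment> \<open>The vertices at which a path can begin its final stay outside \<open>X\<close>.\<close>
  define S where "S = (\<Union>a\<in>X. neighbours E a) - X"
  have S: "finite S" "S \<subseteq> V"
    unfolding S_def using X(1) finite_neighbours edge_pair by (auto simp: neighbours_def)
  have "\<exists>F c \<rho>. path_test S (avoiding_dist X) \<alpha> F c \<rho>"
    by (rule path_test_exists) (use trivial deg S(1) finite_energy_avoiding_dist[OF X(1)] \<alpha> in auto)
  then obtain F1 c1 \<rho>1 where "path_test S (avoiding_dist X) \<alpha> F1 c1 \<rho>1" by blast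
  note F1 = path_testD[OF this]
  have mean: "(\<Sum>P\<in>PP. c P * (\<Sum>e\<in>path_edges P. \<rho> e)) \<le> \<alpha>"
    if "finite PP" "\<And>P. P \<in> PP \<Longrightarrow> source_path P" "\<And>e. e \<in> E \<Longrightarrow> (\<Sum>P | P \<in> PP \<and> e \<in> path_edges P. c P) \<le> \<bar>f e\<bar>"
      "\<And>e. 0 \<le> \<rho> e" "\<And>A. finite A \<Longrightarrow> A \<subseteq> E \<Longrightarrow> (\<Sum>e\<in>A. \<rho> e * \<bar>f e\<bar>) \<le> \<alpha>" for PP c \<rho>
  proof -
    have sub: "(\<Union>P\<in>PP. path_edges P) \<subseteq> E" using path_edges_in_E that(2) by blast
    have "(\<Sum>P\<in>PP. c P * (\<Sum>e\<in>path_edges P. \<rho> e)) \<le> (\<Sum>e\<in>(\<Union>P\<in>PP. path_edges P). \<rho> e * \<bar>f e\<bar>)"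
      using sub by (intro expected_sum_le that(1,3,4)) auto
    also have "\<dots> \<le> \<alpha>" using sub that(1) by (intro that(5)) auto
    finally show ?thesis .
  qed
  define W1 where "W1 = X \<union> S \<union> (F1 \<inter> V)"
  have W1: "finite W1" "W1 \<subseteq> V" "x \<in> W1" "X \<subseteq> W1" "S \<subseteq> W1" unfolding W1_def using X S F1(1) by auto
  \<comment> \<open>The vertex \<open>q\<close> is the end of a path whose \<open>\<rho>1\<close>-length does not exceed the mean.\<close>
  obtain q where q: "q \<in> V - W1" "\<And>v. v \<in> S \<Longrightarrow> \<bar>avoiding_dist X v q - c1 v\<bar> \<le> \<alpha>"
  proof -
    obtain PP c where "path_distribution W1 PP c" using path_distribution_exists[OF W1(1-3)] by blast
    note PP = path_distributionD[OF this]
    have "\<exists>P\<in>PP. (\<Sum>e\<in>path_edges P. \<rho>1 e) \<le> \<alpha>"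
    proof (rule ccontr)
      assume "\<not> ?thesis"
      then have big: "\<alpha> < (\<Sum>e\<in>path_edges P. \<rho>1 e)" if "P \<in> PP" for P using that by (meson not_le)
      obtain P0 where P0: "P0 \<in> PP" "0 < c P0"
        using PP(4,5) by (metis less_eq_real_def sum.neutral zero_neq_one)
      have "\<alpha> = (\<Sum>P\<in>PP. c P * \<alpha>)" using PP(5) by (simp flip: sum_distrib_right)
      also have "\<dots> < (\<Sum>P\<in>PP. c P * (\<Sum>e\<in>path_edges P. \<rho>1 e))"
      proof (rule sum_strict_mono_ex1[OF PP(1)])
        show "\<forall>P\<in>PP. c P * \<alpha> \<le> c P * (\<Sum>e\<in>path_edges P. \<rho>1 e)"
          using big PP(4) by (meson less_imp_le mult_left_mono)
        show "\<exists>P\<in>PP. c P * \<alpha> < c P * (\<Sum>e\<in>path_edges P. \<rho>1 e)"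
          using big P0 mult_strict_left_mono by blast
      qed
      also have "\<dots> \<le> \<alpha>" by (rule mean[OF PP(1,2,6) F1(2,3)])
      finally show False by simp
    qed
    then obtain P where P: "P \<in> PP" "(\<Sum>e\<in>path_edges P. \<rho>1 e) \<le> \<alpha>" by blast
    note path = PP(2)[OF P(1)]
    have last: "last P \<in> set P" using path unfolding source_path_def by simp
    then have lV: "last P \<in> V - W1" using path_vertices[OF path] PP(3)[OF P(1)] by blast
    then have "last P \<notin> F1" unfolding W1_def by auto
    then show thesis using that[OF lV] F1(4)[OF path last] P(2) by fastforce
  qed
  have "\<exists>R. finite R \<and> R \<subseteq> V - X \<and> (\<Sum>r\<in>R. load r) \<le> 1/20 \<and> (avoiding_dist X v q < 1/20 \<longrightarrow> joined E R v q)" for v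
  proof (cases "avoiding_dist X v q < 1/20")
    case True
    then show ?thesis using avoiding_dist_witness[of X v q "1/20"] by (metis div_by_1 frac_le less_eq_real_def one_le_numeral zero_less_one order_refl)
  next
    case False
    then show ?thesis by (intro exI[of _ "{}"]) auto
  qed
  \<comment> \<open>The connections to \<open>q\<close> depend only on the starting vertex in \<open>S\<close>, so they lie in a fixed finite set.
     Where no cheap connection exists, any set of small load, such as the empty one, will do.\<close>
  then obtain R where R: "\<And>v. finite (R v)" "\<And>v. R v \<subseteq> V - X" "\<And>v. (\<Sum>r\<in>R v. load r) \<le> 1/20"
    "\<And>v. avoiding_dist X v q < 1/20 \<Longrightarrow> joined E (R v) v q" by metis
  define F where "F = W1 \<union> (\<Union>v\<in>S. R v)"
  have F: "finite F" "F \<subseteq> V" "x \<in> F" "W1 \<subseteq> F"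
    unfolding F_def using W1(1-3) S(1) R(1) R(2) by auto
  define S2 where "S2 = (\<Union>a\<in>F. neighbours E a) - F"
  have S2: "finite S2" unfolding S2_def using F(1) finite_neighbours by auto
  define K where "K = (\<lambda>y. {z. joined E (V - F) y z})"
  have feK: "finite_energy E tail head (indicator (K y))" for y
    unfolding K_def by (rule finite_energy_component[OF F(1)])
  have "\<exists>F c \<rho>. path_test S2 (\<lambda>y. indicator (K y)) \<alpha> F c \<rho>"
    by (rule path_test_exists) (use trivial deg S2 feK \<alpha> in auto)
  then obtain F2 c2 \<rho>2 where "path_test S2 (\<lambda>y. indicator (K y)) \<alpha> F2 c2 \<rho>2" by blast
  note F2 = path_testD[OF this]
  define W2 where "W2 = F \<union> (F2 \<inter> V)"
  have W2: "finite W2" "W2 \<subseteq> V" "x \<in> W2" "F \<subseteq> W2" unfolding W2_def using F F2(1) by auto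
  obtain PP c where "path_distribution W2 PP c" using path_distribution_exists[OF W2(1-3)] by blast
  note PP = path_distributionD[OF this]
  have XW2: "X \<subseteq> W2" using W1(4) F(4) W2(4) by blast
  have "\<exists>L. L \<noteq> [] \<and> set L \<subseteq> set P \<and> set L \<inter> X = {} \<and> last L = last P \<and> distinct L \<and>
      successively (\<lambda>a b. {a, b} \<in> E) L \<and> (\<exists>a\<in>X. {a, hd L} \<in> E)" if PPP: "P \<in> PP" for P
  proof -
    have "last P \<notin> X" using PP(3)[OF PPP] XW2 by blast
    then obtain Q b M where "P = Q @ b # M" "b \<in> X" "M \<noteq> []" "set M \<inter> X = {}" "last M = last P"
      "distinct M" "successively (\<lambda>a b. {a, b} \<in> E) M" "{b, hd M} \<in> E"
      by (rule path_leaves[OF PP(2)[OF PPP] X(4)])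
    then show ?thesis by (intro exI[of _ M]) auto
  qed
  then obtain L where L: "\<And>P. P \<in> PP \<Longrightarrow> L P \<noteq> [] \<and> set (L P) \<subseteq> set P \<and> set (L P) \<inter> X = {} \<and> last (L P) = last P \<and> distinct (L P) \<and>
      successively (\<lambda>a b. {a, b} \<in> E) (L P) \<and> (\<exists>a\<in>X. {a, hd (L P)} \<in> E)" by metis
  \<comment> \<open>\<open>L P\<close> is a final part of \<open>P\<close> outside \<open>X\<close>; its first vertex \<open>v P\<close> is adjacent to \<open>X\<close>.\<close>
  define v where "v = (\<lambda>P. hd (L P))"
  have vS: "v P \<in> S" if "P \<in> PP" for P
    using L[OF that] unfolding v_def S_def neighbours_def by (auto simp: disjoint_iff)
  define len where "len = (\<lambda>P. \<Sum>r\<in>set P - X. load r)"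
  define r1 where "r1 = (\<lambda>P. \<Sum>e\<in>path_edges P. \<rho>1 e)"
  define r2 where "r2 = (\<lambda>P. \<Sum>e\<in>path_edges P. \<rho>2 e)"
  \<comment> \<open>The individual cost is below \<open>1\<close> only if the three lengths are below \<open>1/100\<close>; the pair cost counts the
     forbidden meetings, so it is below \<open>1\<close> only if there are none.\<close>
  define g where "g = (\<lambda>P. 100 * (len P + r1 P + r2 P))"
  define a where "a = (\<lambda>P Q. real (card ((set P - X) \<inter> set Q)) + real (card (R (v P) \<inter> set Q)) + real (card (R (v Q) \<inter> set P)))"
  have PV: "set P \<subseteq> V" if "P \<in> PP" for P using path_vertices[OF PP(2)[OF that]] .
  have meanlen: "(\<Sum>P\<in>PP. c P * len P) \<le> \<alpha>"
  proof -
    have "(\<Sum>P\<in>PP. c P * len P) \<le> (\<Sum>r\<in>(\<Union>P\<in>PP. set P - X). load r * load r)"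
      unfolding len_def
    proof (rule expected_sum_le[OF PP(1)])
      fix r assume r: "r \<in> (\<Union>P\<in>PP. set P - X)"
      then have "{P. P \<in> PP \<and> r \<in> set P - X} = {P. P \<in> PP \<and> r \<in> set P}" by auto
      then show "(\<Sum>P | P \<in> PP \<and> r \<in> set P - X. c P) \<le> load r" using PP(7)[of r] r PV by auto
    qed (use load_nonneg in auto)
    also have "\<dots> = (\<Sum>r\<in>(\<Union>P\<in>PP. set P - X). (load r)\<^sup>2)" by (simp add: power2_eq_square)
    also have "\<dots> \<le> \<alpha>" using PP(1) PV by (intro tailX) auto
    finally show ?thesis .
  qed
  have hits: "(\<Sum>Q\<in>PP. c Q * real (card (B \<inter> set Q))) \<le> (\<Sum>r\<in>B. load r)" if B: "finite B" "B \<subseteq> V" for B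
  proof -
    have "(\<Sum>Q\<in>PP. c Q * real (card (B \<inter> set Q))) = (\<Sum>Q\<in>PP. c Q * (\<Sum>r\<in>B \<inter> set Q. 1))" by simp
    also have "\<dots> \<le> (\<Sum>r\<in>(\<Union>Q\<in>PP. B \<inter> set Q). 1 * load r)"
    proof (rule expected_sum_le[OF PP(1)])
      fix r assume r: "r \<in> (\<Union>Q\<in>PP. B \<inter> set Q)"
      then have "{P. P \<in> PP \<and> r \<in> B \<inter> set P} = {P. P \<in> PP \<and> r \<in> set P}" by auto
      then show "(\<Sum>P | P \<in> PP \<and> r \<in> B \<inter> set P. c P) \<le> load r" using PP(7)[of r] r PV by auto
    qed auto
    also have "\<dots> \<le> (\<Sum>r\<in>B. load r)"
      using B(1) load_nonneg by (simp, intro sum_mono2) auto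
    finally show ?thesis .
  qed
  have "(\<Sum>P\<in>PP. c P * g P) = 100 * ((\<Sum>P\<in>PP. c P * len P) + (\<Sum>P\<in>PP. c P * r1 P) + (\<Sum>P\<in>PP. c P * r2 P))"
    unfolding g_def sum.distrib[symmetric] sum_distrib_left by (intro sum.cong refl) (simp add: algebra_simps)
  also have "\<dots> \<le> 100 * (\<alpha> + \<alpha> + \<alpha>)"
    unfolding r1_def r2_def
    using meanlen mean[OF PP(1,2,6) F1(2,3)] mean[OF PP(1,2,6) F2(2,3)] by simp
  finally have gmean: "(\<Sum>P\<in>PP. c P * g P) \<le> 3/100" unfolding \<alpha>_def by simp
  have amean: "(\<Sum>P\<in>PP. \<Sum>Q\<in>PP. c P * c Q * a P Q) \<le> \<alpha> + 1/20 + 1/20"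
  proof -
    have t1: "(\<Sum>P\<in>PP. c P * (\<Sum>Q\<in>PP. c Q * real (card ((set P - X) \<inter> set Q)))) \<le> \<alpha>"
    proof -
      have "(\<Sum>P\<in>PP. c P * (\<Sum>Q\<in>PP. c Q * real (card ((set P - X) \<inter> set Q)))) \<le> (\<Sum>P\<in>PP. c P * len P)"
        unfolding len_def using PV PP(4) by (intro sum_mono mult_left_mono hits) auto
      then show ?thesis using meanlen by simp
    qed
    have t2: "(\<Sum>P\<in>PP. c P * (\<Sum>Q\<in>PP. c Q * real (card (R (v P) \<inter> set Q)))) \<le> 1/20"
    proof -
      have "(\<Sum>Q\<in>PP. c Q * real (card (R (v P) \<inter> set Q))) \<le> 1/20" for P
        using hits[of "R (v P)"] R(1)[of "v P"] R(2)[of "v P"] R(3)[of "v P"] by force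
      then have "(\<Sum>P\<in>PP. c P * (\<Sum>Q\<in>PP. c Q * real (card (R (v P) \<inter> set Q)))) \<le> (\<Sum>P\<in>PP. c P * (1/20))"
        using PP(4) by (intro sum_mono mult_left_mono) auto
      then show ?thesis using PP(5) by (simp flip: sum_distrib_right sum_divide_distrib)
    qed
    have "(\<Sum>P\<in>PP. \<Sum>Q\<in>PP. c P * c Q * a P Q) =
       (\<Sum>P\<in>PP. \<Sum>Q\<in>PP. c P * (c Q * real (card ((set P - X) \<inter> set Q)))) +
       (\<Sum>P\<in>PP. \<Sum>Q\<in>PP. c P * (c Q * real (card (R (v P) \<inter> set Q)))) +
       (\<Sum>P\<in>PP. \<Sum>Q\<in>PP. c P * (c Q * real (card (R (v Q) \<inter> set P))))"
      unfolding a_def sum.distrib[symmetric] by (intro sum.cong refl) (simp add: algebra_simps)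
    also have "(\<Sum>P\<in>PP. \<Sum>Q\<in>PP. c P * (c Q * real (card (R (v Q) \<inter> set P)))) =
        (\<Sum>Q\<in>PP. \<Sum>P\<in>PP. c Q * (c P * real (card (R (v Q) \<inter> set P))))"
      by (subst sum.swap) (simp add: mult.left_commute)
    finally show ?thesis using t1 t2 unfolding sum_distrib_left by linarith
  qed
  obtain P0 P1 P2 where P012: "P0 \<in> PP" "P1 \<in> PP" "P2 \<in> PP"
    and cheap: "g P0 + g P1 + g P2 + a P0 P1 + a P0 P2 + a P1 P2 < 1"
    using exists_cheap_triple[OF PP(4,5) gmean amean] unfolding \<alpha>_def by auto
  define Pi where "Pi = (\<lambda>i::nat. if i = 0 then P0 else if i = 1 then P1 else P2)"
  have Pi: "Pi i \<in> PP" for i unfolding Pi_def using P012 by auto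
  have nonneg: "0 \<le> len P" "0 \<le> r1 P" "0 \<le> r2 P" "0 \<le> a P Q" for P Q
    unfolding len_def r1_def r2_def a_def using load_nonneg F1(2) F2(2) by (auto intro: sum_nonneg)
  have g0: "0 \<le> g P" for P unfolding g_def using nonneg by simp
  have "g (Pi i) < 1" for i
    using cheap g0[of P0] g0[of P1] g0[of P2] nonneg(4)[of P0 P1] nonneg(4)[of P0 P2] nonneg(4)[of P1 P2]
    unfolding Pi_def by auto
  then have "100 * (len (Pi i) + r1 (Pi i) + r2 (Pi i)) < 1" for i unfolding g_def .
  then have "len (Pi i) + r1 (Pi i) + r2 (Pi i) < 1/100" for i by (simp add: field_simps)
  then have cost: "len (Pi i) < 1/100" "r1 (Pi i) < 1/100" "r2 (Pi i) < 1/100" for i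
    using nonneg(1-3)[of "Pi i"] by (smt (verit))+
  have zero: "(set P - X) \<inter> set Q = {}" "R (v P) \<inter> set Q = {}" "R (v Q) \<inter> set P = {}" if "a P Q < 1" for P Q
  proof -
    have "card ((set P - X) \<inter> set Q) + card (R (v P) \<inter> set Q) + card (R (v Q) \<inter> set P) = 0"
      using that unfolding a_def by linarith
    then show "(set P - X) \<inter> set Q = {}" "R (v P) \<inter> set Q = {}" "R (v Q) \<inter> set P = {}"
      using R(1) by auto
  qed
  have pairs: "a P0 P1 < 1" "a P0 P2 < 1" "a P1 P2 < 1"
    using cheap g0[of P0] g0[of P1] g0[of P2] nonneg(4)[of P0 P1] nonneg(4)[of P0 P2] nonneg(4)[of P1 P2] by linarith+
  have sep: "(set (Pi i) - X) \<inter> (set (Pi j) - X) = {} \<and> R (v (Pi i)) \<inter> set (Pi j) = {}"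
    if "i < 3" "j < 3" "i \<noteq> j" for i j
  proof -
    have "i = 0 \<or> i = 1 \<or> i = 2" "j = 0 \<or> j = 1 \<or> j = 2" using that by auto
    then show ?thesis
      using that(3) zero[OF pairs(1)] zero[OF pairs(2)] zero[OF pairs(3)] unfolding Pi_def
      by (elim disjE) (simp_all, blast+)
  qed
  have lastP: "last (Pi i) \<in> set (Pi i)" "last (Pi i) \<in> V" "last (Pi i) \<notin> F1" "last (Pi i) \<notin> F2" for i
  proof -
    show "last (Pi i) \<in> set (Pi i)" using PP(2)[OF Pi, of i] unfolding source_path_def by simp
    then show 1: "last (Pi i) \<in> V" using PV[OF Pi] by blast
    then show "last (Pi i) \<notin> F1" "last (Pi i) \<notin> F2"
      using PP(3)[OF Pi, of i] F(4) unfolding W2_def W1_def by blast+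
  qed
  \<comment> \<open>The path itself shows that its end is close to \<open>v (Pi i)\<close>. The distance from \<open>v (Pi i)\<close> is nearly the same
     at \<open>q\<close> as at the end of the path, so \<open>q\<close> is close to \<open>v (Pi i)\<close>, too.\<close>
  have Rj: "joined E (R (v (Pi i))) (v (Pi i)) q" for i
  proof (rule R(4))
    note Li = L[OF Pi, of i] and vi = vS[OF Pi, of i]
    have "last (Pi i) \<in> set (L (Pi i))" using Li last_in_set[of "L (Pi i)"] by simp
    then have "joined E (set (L (Pi i))) (v (Pi i)) (last (Pi i))"
      unfolding v_def using Li by (intro joined_from_hd) auto
    then have "avoiding_dist X (v (Pi i)) (last (Pi i)) \<le> (\<Sum>r\<in>set (L (Pi i)). load r)"
      using Li PV[OF Pi, of i] by (intro avoiding_dist_le) auto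
    also have "\<dots> \<le> len (Pi i)" unfolding len_def using Li load_nonneg by (intro sum_mono2) auto
    finally have "avoiding_dist X (v (Pi i)) (last (Pi i)) < 1/100" using cost(1)[of i] by simp
    moreover have "\<bar>avoiding_dist X (v (Pi i)) (last (Pi i)) - c1 (v (Pi i))\<bar> < 1/100"
      using F1(4)[OF PP(2)[OF Pi] lastP(1,3) vi, of i] cost(2)[of i] unfolding r1_def by simp
    moreover have "\<bar>avoiding_dist X (v (Pi i)) q - c1 (v (Pi i))\<bar> \<le> 1/10000" using q(2)[OF vi] unfolding \<alpha>_def .
    ultimately show "avoiding_dist X (v (Pi i)) q < 1/20" by linarith
  qed
  \<comment> \<open>The component that contains the end of the first path; the indicator test forces the other two into it.\<close>
  obtain y where y: "y \<in> S2" "last (Pi 0) \<in> K y"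
  proof -
    have "last (Pi 0) \<notin> F" using PP(3)[OF Pi] W2(4) by blast
    then obtain Q b M where Q: "Pi 0 = Q @ b # M" "b \<in> F" "M \<noteq> []" "set M \<inter> F = {}" "last M = last (Pi 0)"
      "distinct M" "successively (\<lambda>a b. {a, b} \<in> E) M" "{b, hd M} \<in> E"
      by (rule path_leaves[OF PP(2)[OF Pi] F(3)])
    have MV: "set M \<subseteq> V - F" using PV[OF Pi, of 0] Q(1,4) by auto
    have "last (Pi 0) \<in> set M" using Q(3,5) last_in_set[of M] by simp
    then have "joined E (V - F) (hd M) (last (Pi 0))" using Q(7) MV by (intro joined_from_hd)
    then have "last (Pi 0) \<in> K (hd M)" unfolding K_def by simp
    moreover have "hd M \<in> S2"
      unfolding S2_def neighbours_def using Q(2,8) hd_in_set[OF Q(3)] Q(4) by blast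
    ultimately show thesis using that by blast
  qed
  have lastK: "last (Pi i) \<in> K y" for i
  proof -
    have d: "\<bar>indicator (K y) (last (Pi j)) - c2 y\<bar> < 1/100" for j
      using F2(4)[OF PP(2)[OF Pi] lastP(1,4) y(1), of j] cost(3)[of j] unfolding r2_def by simp
    show ?thesis
    proof (rule ccontr)
      assume "last (Pi i) \<notin> K y"
      then have "\<bar>c2 y\<bar> < 1/100" using d[of i] by simp
      moreover have "\<bar>1 - c2 y\<bar> < 1/100" using d[of 0] y(2) by simp
      ultimately show False by linarith
    qed
  qed
  have KV: "K y \<subseteq> V - F" unfolding K_def using joined_right by fast
  have Kconn: "connected_in E (K y)"
  proof (rule connected_inI[of _ _ y])
    fix b assume "b \<in> K y"
    then have "joined E (V - F) y b" unfolding K_def by simp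
    then show "joined E (K y) y b"
    proof (induction rule: joined_induct)
      case refl
      then show ?case unfolding K_def by (auto intro!: joined_refl)
    next
      case (step b c)
      then show ?case unfolding K_def by (auto intro: joined_step)
    qed
  qed
  \<comment> \<open>The arms are stopped when they enter \<open>K y\<close> for the first time. This keeps them disjoint from \<open>K y\<close>, however
     far they wander before they come back to their connections.\<close>
  have "\<exists>T. T \<noteq> [] \<and> hd T = v (Pi i) \<and> distinct T \<and> successively (\<lambda>a b. {a, b} \<in> E) T \<and> set T \<subseteq> set (L (Pi i)) \<and>
     set T \<inter> K y = {} \<and> (\<exists>k\<in>K y. {k, last T} \<in> E)" for i
  proof -
    note Li = L[OF Pi, of i]
    have "last (Pi i) \<in> set (L (Pi i))" using Li by (metis last_in_set)
    then obtain T k Q where T: "L (Pi i) = T @ k # Q" "k \<in> K y" "\<forall>b\<in>set T. b \<notin> K y"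
      using lastK[of i] split_list_first_prop[of "L (Pi i)" "\<lambda>b. b \<in> K y"] by blast
    have "v (Pi i) \<notin> K y" using vS[OF Pi, of i] W1(5) F(4) KV by blast
    then have ne: "T \<noteq> []" using T unfolding v_def by auto
    then have "hd T = v (Pi i)" unfolding v_def T(1) by simp
    moreover have "distinct T" "successively (\<lambda>a b. {a, b} \<in> E) T" "{k, last T} \<in> E"
      using Li ne unfolding T(1) by (auto simp: successively_append_iff insert_commute)
    ultimately show ?thesis using ne T by (intro exI[of _ T]) auto
  qed
  then obtain T where T: "\<And>i. T i \<noteq> []" "\<And>i. hd (T i) = v (Pi i)" "\<And>i. distinct (T i)"
     "\<And>i. successively (\<lambda>a b. {a, b} \<in> E) (T i)" "\<And>i. set (T i) \<subseteq> set (L (Pi i))"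
     "\<And>i. set (T i) \<inter> K y = {}" "\<And>i. \<exists>k\<in>K y. {k, last (T i)} \<in> E" by metis
  have TP: "set (T i) \<subseteq> set (Pi i) - X" for i using T(5)[of i] L[OF Pi, of i] by blast
  have XF: "X \<subseteq> F" using W1(4) F(4) by blast
  show False
  proof (rule no_three_arms[OF emb X(2,5) _ Kconn, of T "\<lambda>i. R (v (Pi i))" q])
    show "K y \<subseteq> V" using KV by blast
    show "X \<inter> K y = {}" using KV XF by blast
    show "T i \<noteq> []" "distinct (T i)" "successively (\<lambda>a b. {a, b} \<in> E) (T i)" for i by (fact T)+
    show "set (T i) \<subseteq> V - X - K y" for i using TP[of i] T(6)[of i] PV[OF Pi, of i] by blast
    show "\<exists>a\<in>X. {a, hd (T i)} \<in> E" for i using L[OF Pi, of i] T(2)[of i] unfolding v_def by simp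
    show "\<exists>k\<in>K y. {k, last (T i)} \<in> E" for i by (fact T)
    show "set (T i) \<inter> set (T j) = {}" if "i < 3" "j < 3" "i \<noteq> j" for i j
      using sep[OF that] TP[of i] TP[of j] by blast
    show "R (v (Pi i)) \<subseteq> V - X - K y" for i
    proof -
      have "R (v (Pi i)) \<subseteq> F" unfolding F_def using vS[OF Pi, of i] by blast
      then show ?thesis using R(2)[of "v (Pi i)"] KV by blast
    qed
    show "joined E (R (v (Pi i))) (hd (T i)) q" for i using Rj[of i] T(2)[of i] by simp
    show "R (v (Pi i)) \<inter> set (T j) = {}" if "i < 3" "j < 3" "i \<noteq> j" for i j
      using sep[OF that] TP[of j] by blast
  qed
qed

end

theorem corollary1p3:
  fixes V :: "'a set" and E :: "'a set set"
    and tail head :: "'a set \<Rightarrow> 'a"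
    and x :: 'a and f :: "'a set \<Rightarrow> real"
  assumes "simple_graph V E"
    and "orientation E tail head"
    and "locally_finite_graph V E"
    and "planar_graph V E"
    and "flow_from V E tail head x f"
    and "(\<lambda>e. ((real (vertex_degree E (tail e)))\<^sup>2 + (real (vertex_degree E (head e)))\<^sup>2) * (f e)\<^sup>2) summable_on E"
  shows "\<exists>u :: 'a \<Rightarrow> real. dirichlet_harmonic V E tail head u \<and> \<not> u constant_on V"
proof (rule ccontr)
  assume contra: "\<not> ?thesis"
  interpret network V E tail head by unfold_locales (fact assms)+
  have x: "x \<in> V" and flow: "\<And>z. z \<in> V \<Longrightarrow> z \<noteq> x \<Longrightarrow> divergence E tail head f z = 0"
    and fx: "divergence E tail head f x \<noteq> 0"
    using assms(5) unfolding flow_from_def by auto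
  have nx: "neighbours E x \<noteq> {}"
  proof
    assume "neighbours E x = {}"
    then have "incident_edges E x = {}" unfolding incident_edges_eq by simp
    then have "{e \<in> E. tail e = x} = {}" "{e \<in> E. head e = x} = {}"
      using edge_ends unfolding incident_edges_def by blast+
    then show False using fx unfolding divergence_def by (simp only: sum.empty)
  qed
  have nbr: "neighbours E z \<noteq> {}" if "joined E V x z" for z
    using that
  proof (induction rule: joined_induct)
    case (step b c)
    then show ?case unfolding neighbours_def by (auto simp: insert_commute)
  qed (rule nx)
  have conn: "joined E V x z" if z: "z \<in> V" for z
  proof (rule ccontr)
    assume nz: "\<not> joined E V x z"
    \<comment> \<open>At an isolated vertex harmonicity requires the value \<open>0\<close>, and the component of \<open>x\<close>, on which \<open>h\<close> is \<open>1\<close>, has no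
       isolated vertices.\<close>
    define h :: "'a \<Rightarrow> real" where "h = indicator {z. joined E V x z}"
    have same: "h a = h b" if "{a, b} \<in> E" for a b
      using that edge_pair[OF that] joined_step[of E V x a b] joined_step[of E V x b a]
      unfolding h_def indicator_def by (auto simp: insert_commute)
    have "harmonic V E h"
      unfolding harmonic_def
    proof
      fix w assume w: "w \<in> V"
      show "h w = 1 / real (vertex_degree E w) * (\<Sum>y\<in>neighbours E w. h y)"
      proof (cases "joined E V x w")
        case True
        have "(\<Sum>y\<in>neighbours E w. h w - h y) = 0"
          using same[of w] by (intro sum.neutral) (auto simp: neighbours_def)
        then show ?thesis by (rule harmonic_atI[OF nbr[OF True]])
      next
        case False
        then have w0: "h w = 0" unfolding h_def by simp
        have "(\<Sum>y\<in>neighbours E w. h y) = 0"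
          using same[of w] w0 by (intro sum.neutral) (auto simp: neighbours_def)
        then show ?thesis using w0 by simp
      qed
    qed
    moreover have "finite_energy E tail head h"
    proof (rule finite_energy_finite_support)
      have "grad h e = 0" if "e \<in> E" for e
        using same[of "tail e" "head e"] edge(1)[OF that] that unfolding grad_def by simp
      then have "{e \<in> E. grad h e \<noteq> 0} = {}" by blast
      then show "finite {e \<in> E. grad h e \<noteq> 0}" by (simp only: finite.emptyI)
    qed
    moreover have "\<not> h constant_on V"
    proof
      assume "h constant_on V"
      then have "h x = h z" using x z unfolding constant_on_def by metis
      then show False using nz x unfolding h_def by (simp add: joined_refl)
    qed
    ultimately show False using contra unfolding dirichlet_harmonic_def by blast
  qed
  define \<kappa> where "\<kappa> = divergence E tail head f x"
  define f1 where "f1 = (\<lambda>e. f e / \<kappa>)"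
  have div: "divergence E tail head f1 z = divergence E tail head f z / \<kappa>" for z
    unfolding divergence_def f1_def by (simp add: sum_divide_distrib diff_divide_distrib)
  interpret unit_flow V E tail head x f1
  proof
    show "x \<in> V" by (fact x)
    show "joined E V x z" if "z \<in> V" for z using conn[OF that] .
    show "divergence E tail head f1 z = 0" if "z \<in> V" "z \<noteq> x" for z using flow[OF that] by (simp add: div)
    show "divergence E tail head f1 x = 1" using fx unfolding div \<kappa>_def by simp
    have "(\<lambda>e. (1 / \<kappa>\<^sup>2) * (((real (vertex_degree E (tail e)))\<^sup>2 + (real (vertex_degree E (head e)))\<^sup>2) * (f e)\<^sup>2)) summable_on E"
      by (intro summable_on_cmult_right assms(6))
    then show "(\<lambda>e. ((real (vertex_degree E (tail e)))\<^sup>2 + (real (vertex_degree E (head e)))\<^sup>2) * (f1 e)\<^sup>2) summable_on E"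
      unfolding f1_def by (simp add: power_divide)
  qed
  show False
    by (rule not_planar_if_liouville[OF _ _ assms(4)]) (use contra nbr conn in auto)
qed

end
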